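(* Let $\mathsf{P}$ be a poset on $[n]$. Then the weighted quasisymmetric enumerator $F_q(C(\mathsf{P}))$ of the poset cone $C(\mathsf{P})$ equals the value at $[\mathsf{P}]$ of the universal morphism $\Psi_q:(\mathcal{P},\zeta_q)\to(\mathcal{Q}Sym,\zeta_\mathcal{Q})$ from the combinatorial Hopf algebra of posets to quasisymmetric functions: $$F_q(C(\mathsf{P}))=\Psi_q([\mathsf{P}]).$$
   Context: Geometric side. For a poset $\mathsf{P}$ on $[n]=\{1,\ldots,n\}$ the poset cone is $C(\mathsf{P})=\mathrm{cone}\{e_i-e_j: i<_\mathsf{P}j\}\subseteq\mathbb{R}^n$, where $e_1,\ldots,e_n$ is the standard basis. For a nonempty face $G$ of $C(\mathsf{P})$ (including $C(\mathsf{P})$ itself), $C_G^\circ$ denotes the relative interior of the normal cone at $G$, i.e. the set of $\omega\in\mathbb{R}^n$ such that $x\mapsto\langle\omega,x\rangle$ attains a maximum on $C(\mathsf{P})$ and the set of maximizers is exactly $G$. With $\mathbb{Z}^n_+$ the set of vectors of positive integers and $L(C(\mathsf{P}))$ the set of nonempty faces, define $$F_q(C(\mathsf{P}))=\sum_{G\in L(C(\mathsf{P}))}q^{\dim G}\sum_{\omega\in\mathbb{Z}^n_+\cap C_G^\circ}x_{\omega_1}x_{\omega_2}\cdots x_{\omega_n},$$ a quasisymmetric function in the ordered variables $x_1<x_2<\cdots$ with coefficients polynomial in the indeterminate $q$. Algebraic side. Let $\mathbf{k}$ be a field and work over the field of rational functions $\mathbf{k}(q)$. $\mathcal{Q}Sym$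 is the graded connected Hopf algebra spanned by the monomial quasisymmetric functions $M_\alpha=\sum_{i_1<\cdots<i_k}x_{i_1}^{\alpha_1}\cdots x_{i_k}^{\alpha_k}$, $\alpha=(\alpha_1,\ldots,\alpha_k)$ running over compositions (with $M_{()}=1$), with product that of power series and coproduct $\Delta(M_\alpha)=\sum_{\alpha=\beta\cdot\gamma}M_\beta\otimes M_\gamma$ (sum over ways to write $\alpha$ as a concatenation). Its character $\zeta_\mathcal{Q}$ is the multiplicative linear functional with $\zeta_\mathcal{Q}(M_\alpha)=1$ if $\alpha$ has at most one part and $0$ otherwise. $\mathcal{P}=\bigoplus_{n\ge0}\mathcal{P}_n$ is the graded Hopf algebra with basis the isomorphism classes $[\mathsf{P}]$ of finite posets ($\mathcal{P}_n$ spanned by posets on $[n]$), with product $[\mathsf{P}_1]\cdot[\mathsf{P}_2]=[\mathsf{P}_1\sqcup\mathsf{P}_2]$ (disjoint union) and coproduct $\Delta([\mathsf{P}])=\sum_{S\lhd\mathsf{P}}[\mathsf{P}|_S]\otimes[\mathsf{P}|_{[n]\setminus S}]$, where $\mathsf{P}|_S$ is the restriction to $S$ and $S\lhd\mathsf{P}$ means that $S\subseteq[n]$ is an ideal: no element of $[n]\setminus S$ is less than an element of $S$. Its character is $\zeta_q([\mathsf{P}])=q^{\mathrm{rk}(\mathsf{P})}$ with $\mathrm{rk}(\mathsf{P})=n-c(\mathsf{P})$, where $c(\mathsf{P})$ is the number of connected components of $\mathsf{P}$ (of its Hasse diagram). $\Psi_q:\mathcal{P}\to\mathcal{Q}Sym$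 is the unique morphism of graded Hopf algebras over $\mathbf{k}(q)$ with $\zeta_\mathcal{Q}\circ\Psi_q=\zeta_q$ (existence and uniqueness is the theorem of Aguiar, Bergeron and Sottile). *)

theory Defs
  imports
    "HOL-Analysis.Analysis"
    "HOL-Analysis.Finite_Function_Topology"
    "HOL-Computational_Algebra.Fraction_Field"
    "HOL-Computational_Algebra.Polynomial"
begin

section \<open>The weighted enumerator of a poset cone\<close>

text \<open>
  A poset on \<open>[n] = {1..n}\<close> is a reflexive relation \<open>P\<close> with \<open>partial_order_on {1..n} P\<close>; the strict
  order is \<open>(i, j) \<in> P \<and> i \<noteq> j\<close>. The space \<open>\<real>\<^sup>n\<close> is the set of all \<open>v :: nat \<Rightarrow>\<^sub>0 real\<close> supported on
  \<open>{1..n}\<close>, so that \<open>n\<close> may be any natural number, \<open>0\<close> included. The ambient type is a real vector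
  space, hence the library notions of convex cone, face and dimension apply.
\<close>

definition Rn :: "nat \<Rightarrow> (nat \<Rightarrow>\<^sub>0 real) set" where
  "Rn n = {v. Poly_Mapping.keys v \<subseteq> {1..n}}"

definition unit_vec :: "nat \<Rightarrow> (nat \<Rightarrow>\<^sub>0 real)" where
  "unit_vec i = Poly_Mapping.single i 1"

definition dot :: "nat \<Rightarrow> (nat \<Rightarrow>\<^sub>0 real) \<Rightarrow> (nat \<Rightarrow>\<^sub>0 real) \<Rightarrow> real" where
  "dot n v w = (\<Sum>i\<in>{1..n}. Poly_Mapping.lookup v i * Poly_Mapping.lookup w i)"

text \<open>The convex cone hull of the empty set is \<open>{0}\<close>, as it should be for an antichain.\<close>

definition poset_cone :: "nat rel \<Rightarrow> (nat \<Rightarrow>\<^sub>0 real) set" where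
  "poset_cone P = convex_cone hull {unit_vec i - unit_vec j | i j. (i, j) \<in> P \<and> i \<noteq> j}"

definition nonempty_faces :: "(nat \<Rightarrow>\<^sub>0 real) set \<Rightarrow> (nat \<Rightarrow>\<^sub>0 real) set set" where
  "nonempty_faces C = {G. G face_of C \<and> G \<noteq> {}}"

text \<open>
  \<open>\<omega>\<close> lies in the following set iff the linear functional given by \<open>\<omega>\<close> attains its maximum on \<open>C\<close>
  exactly on \<open>G\<close>; that the maximum is attained is the non-emptiness of \<open>G\<close>.
\<close>

definition open_normal_cone ::
    "nat \<Rightarrow> (nat \<Rightarrow>\<^sub>0 real) set \<Rightarrow> (nat \<Rightarrow>\<^sub>0 real) set \<Rightarrow> (nat \<Rightarrow>\<^sub>0 real) set" where
  "open_normal_cone n C G =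
     {\<omega> \<in> Rn n. G \<noteq> {} \<and> {x \<in> C. \<forall>y\<in>C. dot n \<omega> y \<le> dot n \<omega> x} = G}"

definition pos_int_vecs :: "nat \<Rightarrow> (nat \<Rightarrow>\<^sub>0 real) set" where
  "pos_int_vecs n =
     {\<omega> \<in> Rn n. \<forall>i\<in>{1..n}. Poly_Mapping.lookup \<omega> i \<in> \<int> \<and> Poly_Mapping.lookup \<omega> i > 0}"

text \<open>
  A formal power series in \<open>x\<^sub>1, x\<^sub>2, \<dots>\<close> is its coefficient function; a monomial is its
  exponent vector \<open>nat \<Rightarrow>\<^sub>0 nat\<close>, multiplication of monomials being addition. The index \<open>0\<close> is
  never used by the series below.
\<close>

type_synonym 'c series = "(nat \<Rightarrow>\<^sub>0 nat) \<Rightarrow> 'c"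

definition series_mult :: "'c::comm_ring_1 series \<Rightarrow> 'c series \<Rightarrow> 'c series" where
  "series_mult f g = (\<lambda>m. \<Sum>(a, b) | a + b = m. f a * g b)"

text \<open>The monomial \<open>x(\<omega>\<^sub>1) x(\<omega>\<^sub>2) \<dots> x(\<omega>\<^sub>n)\<close> of a positive integer vector.\<close>

definition vec_monomial :: "nat \<Rightarrow> (nat \<Rightarrow>\<^sub>0 real) \<Rightarrow> (nat \<Rightarrow>\<^sub>0 nat)" where
  "vec_monomial n \<omega> = (\<Sum>i\<in>{1..n}. Poly_Mapping.single (nat \<lfloor>Poly_Mapping.lookup \<omega> i\<rfloor>) 1)"

text \<open>
  The field \<open>\<k>(q)\<close> is \<open>'k poly fract\<close>. In the enumerator, the inner formal sum of monomials has as
  its coefficient at \<open>m\<close> the (finite) number of \<open>\<omega>\<close> with monomial \<open>m\<close>. Every nonempty face of a cone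
  contains \<open>0\<close>, so its dimension is that of its linear span, which is the library's \<^const>\<open>dim\<close>.
  A poset cone has only finitely many faces, each being generated by a subset of the generators.
\<close>

definition qvar :: "'k::field poly fract" where
  "qvar = Fract [:0, 1:] 1"

definition cone_enumerator :: "nat \<Rightarrow> (nat \<Rightarrow>\<^sub>0 real) set \<Rightarrow> 'k::field poly fract series" where
  "cone_enumerator n C = (\<lambda>m. \<Sum>G\<in>nonempty_faces C.
     qvar ^ dim G *
     of_nat (card {\<omega> \<in> pos_int_vecs n \<inter> open_normal_cone n C G. vec_monomial n \<omega> = m}))"


section \<open>Free vector spaces\<close>

text \<open>
  The vector space over a field \<open>'c\<close> with basis \<open>'b\<close> is \<open>'b \<Rightarrow>\<^sub>0 'c\<close>, and the tensor product of the
  spaces with bases \<open>'a\<close> and \<open>'b\<close> is the space with basis \<open>'a \<times> 'b\<close>.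
\<close>

definition scale :: "'c::field \<Rightarrow> ('b \<Rightarrow>\<^sub>0 'c) \<Rightarrow> ('b \<Rightarrow>\<^sub>0 'c)" where
  "scale c = Poly_Mapping.map ((*) c)"

definition basis :: "'b \<Rightarrow> ('b \<Rightarrow>\<^sub>0 'c::field)" where
  "basis b = Poly_Mapping.single b 1"

definition lin_ext :: "('a \<Rightarrow> 'b \<Rightarrow>\<^sub>0 'c::field) \<Rightarrow> ('a \<Rightarrow>\<^sub>0 'c) \<Rightarrow> ('b \<Rightarrow>\<^sub>0 'c)" where
  "lin_ext f x = (\<Sum>a\<in>Poly_Mapping.keys x. scale (Poly_Mapping.lookup x a) (f a))"

definition lin_form :: "('a \<Rightarrow> 'c::field) \<Rightarrow> ('a \<Rightarrow>\<^sub>0 'c) \<Rightarrow> 'c" where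
  "lin_form f x = (\<Sum>a\<in>Poly_Mapping.keys x. Poly_Mapping.lookup x a * f a)"

definition tensor :: "('a \<Rightarrow>\<^sub>0 'c::field) \<Rightarrow> ('b \<Rightarrow>\<^sub>0 'c) \<Rightarrow> ('a \<times> 'b \<Rightarrow>\<^sub>0 'c)" where
  "tensor u v = (\<Sum>a\<in>Poly_Mapping.keys u. \<Sum>b\<in>Poly_Mapping.keys v.
     Poly_Mapping.single (a, b) (Poly_Mapping.lookup u a * Poly_Mapping.lookup v b))"

text \<open>The map \<open>F \<otimes> F\<close>.\<close>

definition tensor_map ::
    "(('a \<Rightarrow>\<^sub>0 'c::field) \<Rightarrow> ('b \<Rightarrow>\<^sub>0 'c)) \<Rightarrow> ('a \<times> 'a \<Rightarrow>\<^sub>0 'c) \<Rightarrow> ('b \<times> 'b \<Rightarrow>\<^sub>0 'c)" where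
  "tensor_map F = lin_ext (\<lambda>(a, b). tensor (F (basis a)) (F (basis b)))"

lemma lookup_scale [simp]:
  "Poly_Mapping.lookup (scale c x) a = c * Poly_Mapping.lookup x a"
  by (simp add: scale_def Poly_Mapping.map.rep_eq when_def)

lemma vector_space_scale: "vector_space (scale :: 'c::field \<Rightarrow> ('b \<Rightarrow>\<^sub>0 'c) \<Rightarrow> _)"
  by unfold_locales (auto intro!: poly_mapping_eqI simp: lookup_add algebra_simps)


section \<open>Quasisymmetric functions\<close>

typedef composition = "{\<alpha> :: nat list. \<forall>a\<in>set \<alpha>. a > 0}"
  morphisms parts composition
  by (rule exI[of _ "[]"]) simp

text \<open>
  The coefficient of \<open>m\<close> in \<open>M\<^sub>\<alpha>\<close> is the number of sequences \<open>0 < i\<^sub>1 < \<dots> < i\<^sub>k\<close> for which the product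
  of the powers of \<open>x(i\<^sub>1), \<dots>, x(i\<^sub>k)\<close> with exponents \<open>\<alpha>\<^sub>1, \<dots>, \<alpha>\<^sub>k\<close> is \<open>m\<close>.
\<close>

definition M_series :: "composition \<Rightarrow> 'c::field series" where
  "M_series \<alpha> = (\<lambda>m. of_nat (card {js :: nat list.
     length js = length (parts \<alpha>) \<and> sorted_wrt (<) js \<and> (\<forall>j\<in>set js. j > 0) \<and>
     (\<Sum>k<length js. Poly_Mapping.single (js ! k) (parts \<alpha> ! k)) = m}))"

text \<open>
  QSym is the space with basis the compositions, \<open>basis \<alpha>\<close> standing for \<open>M\<^sub>\<alpha>\<close>; the following
  (injective) map sends an element to the power series it denotes. The product of QSym is the
  product of these power series.
\<close>

type_synonym 'c qsym = "composition \<Rightarrow>\<^sub>0 'c"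

definition qsym_series :: "'c::field qsym \<Rightarrow> 'c series" where
  "qsym_series f =
     (\<lambda>m. \<Sum>\<alpha>\<in>Poly_Mapping.keys f. Poly_Mapping.lookup f \<alpha> * M_series \<alpha> m)"

definition qsym_unit :: "'c::field qsym" where
  "qsym_unit = basis (composition [])"

definition qsym_comult :: "'c::field qsym \<Rightarrow> (composition \<times> composition \<Rightarrow>\<^sub>0 'c)" where
  "qsym_comult = lin_ext (\<lambda>\<alpha>. \<Sum>(\<beta>, \<gamma>) | parts \<beta> @ parts \<gamma> = parts \<alpha>. basis (\<beta>, \<gamma>))"

definition qsym_counit :: "'c::field qsym \<Rightarrow> 'c" where
  "qsym_counit = lin_form (\<lambda>\<alpha>. if parts \<alpha> = [] then 1 else 0)"

definition qsym_homogeneous :: "nat \<Rightarrow> 'c::field qsym set" where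
  "qsym_homogeneous n = {f. \<forall>\<alpha>\<in>Poly_Mapping.keys f. sum_list (parts \<alpha>) = n}"

definition zeta_Q :: "'c::field qsym \<Rightarrow> 'c" where
  "zeta_Q = lin_form (\<lambda>\<alpha>. if length (parts \<alpha>) \<le> 1 then 1 else 0)"


section \<open>Isomorphism classes of finite posets\<close>

definition poset_iso :: "nat set \<times> nat rel \<Rightarrow> nat set \<times> nat rel \<Rightarrow> bool" where
  "poset_iso = (\<lambda>(A, r) (B, s).
     finite A \<and> partial_order_on A r \<and> finite B \<and> partial_order_on B s \<and>
     (\<exists>f. bij_betw f A B \<and> (\<forall>x\<in>A. \<forall>y\<in>A. (x, y) \<in> r \<longleftrightarrow> (f x, f y) \<in> s)))"

lemma poset_iso_refl: "finite A \<Longrightarrow> partial_order_on A r \<Longrightarrow> poset_iso (A, r) (A, r)"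
  by (auto simp: poset_iso_def intro!: exI[of _ id])

lemma poset_iso_sym:
  assumes "poset_iso P Q" shows "poset_iso Q P"
proof -
  obtain A r B s where PQ: "P = (A, r)" "Q = (B, s)" by (metis surj_pair)
  from assms obtain f where f: "bij_betw f A B"
      "\<forall>x\<in>A. \<forall>y\<in>A. (x, y) \<in> r \<longleftrightarrow> (f x, f y) \<in> s"
    by (auto simp: poset_iso_def PQ)
  have "bij_betw (inv_into A f) B A" using f(1) by (rule bij_betw_inv_into)
  moreover have "\<forall>x\<in>B. \<forall>y\<in>B. (x, y) \<in> s \<longleftrightarrow> (inv_into A f x, inv_into A f y) \<in> r"
  proof (intro ballI)
    fix x y assume "x \<in> B" "y \<in> B"
    then have "inv_into A f x \<in> A" "inv_into A f y \<in> A"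
      "f (inv_into A f x) = x" "f (inv_into A f y) = y"
      using f(1) by (auto simp: bij_betw_def inv_into_into f_inv_into_f)
    then show "(x, y) \<in> s \<longleftrightarrow> (inv_into A f x, inv_into A f y) \<in> r"
      using f(2) by metis
  qed
  ultimately show ?thesis using assms by (auto simp: poset_iso_def PQ)
qed

lemma poset_iso_trans:
  assumes "poset_iso P Q" "poset_iso Q R" shows "poset_iso P R"
proof -
  obtain A r B s C t where PQR: "P = (A, r)" "Q = (B, s)" "R = (C, t)" by (metis surj_pair)
  from assms obtain f g where f: "bij_betw f A B"
      "\<forall>x\<in>A. \<forall>y\<in>A. (x, y) \<in> r \<longleftrightarrow> (f x, f y) \<in> s"
    and g: "bij_betw g B C" "\<forall>x\<in>B. \<forall>y\<in>B. (x, y) \<in> s \<longleftrightarrow> (g x, g y) \<in> t"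
    by (auto simp: poset_iso_def PQR)
  have "bij_betw (g \<circ> f) A C" using f(1) g(1) by (rule bij_betw_trans)
  moreover have "\<forall>x\<in>A. \<forall>y\<in>A. (x, y) \<in> r \<longleftrightarrow> ((g \<circ> f) x, (g \<circ> f) y) \<in> t"
    using f g by (auto dest: bij_betwE)
  ultimately show ?thesis using assms by (auto simp: poset_iso_def PQR)
qed

lemma poset_iso_imageI:
  assumes "finite A" "partial_order_on A r" "inj_on f A" "B = f ` A" "s = map_prod f f ` r"
  shows "poset_iso (A, r) (B, s)"
proof -
  have sub: "r \<subseteq> A \<times> A" using assms(2) by (rule partial_order_onD(4))
  have iff: "(f x, f y) \<in> s \<longleftrightarrow> (x, y) \<in> r" if "x \<in> A" "y \<in> A" for x y
  proof
    assume "(f x, f y) \<in> s"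
    then obtain a b where ab: "(a, b) \<in> r" "f x = f a" "f y = f b"
      using assms(5) by auto
    then have "x = a" "y = b" using sub that assms(3) by (auto dest: inj_onD)
    then show "(x, y) \<in> r" using ab(1) by simp
  next
    assume "(x, y) \<in> r" then show "(f x, f y) \<in> s" using assms(5) by auto
  qed
  have "partial_order_on B s"
    unfolding partial_order_on_def preorder_on_def
  proof (intro conjI)
    show "s \<subseteq> B \<times> B" using sub assms(4,5) by auto
    show "refl_on B s" using assms(4) iff partial_order_onD(1)[OF assms(2)]
      by (auto simp: refl_on_def)
    show "trans s"
    proof (rule transI)
      fix x y z assume "(x, y) \<in> s" "(y, z) \<in> s"
      then obtain a b c where "x = f a" "y = f b" "z = f c" "a \<in> A" "b \<in> A" "c \<in> A"
        using assms(4) \<open>s \<subseteq> B \<times> B\<close> by blast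
      then show "(x, z) \<in> s"
        using iff \<open>(x, y) \<in> s\<close> \<open>(y, z) \<in> s\<close> partial_order_onD(2)[OF assms(2)]
        by (auto elim: transE)
    qed
    show "antisym s"
    proof (rule antisymI)
      fix x y assume "(x, y) \<in> s" "(y, x) \<in> s"
      then obtain a b where "x = f a" "y = f b" "a \<in> A" "b \<in> A"
        using assms(4) \<open>s \<subseteq> B \<times> B\<close> by blast
      then show "x = y"
        using iff \<open>(x, y) \<in> s\<close> \<open>(y, x) \<in> s\<close> partial_order_onD(3)[OF assms(2)]
        by (auto dest: antisymD)
    qed
  qed
  moreover have "bij_betw f A B" using assms(3,4) by (simp add: bij_betw_def)
  moreover have "\<forall>x\<in>A. \<forall>y\<in>A. (x, y) \<in> r \<longleftrightarrow> (f x, f y) \<in> s" using iff by blast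
  moreover have "finite B" using assms(1,4) by simp
  ultimately show ?thesis
    unfolding poset_iso_def prod.case using assms(1,2) by blast
qed

lemma poset_isoE:
  assumes "poset_iso (A, r) (B, s)"
  obtains f where "finite A" "partial_order_on A r" "inj_on f A" "B = f ` A"
    "s = map_prod f f ` r" "finite B" "partial_order_on B s"
proof -
  from assms obtain f where f: "bij_betw f A B"
      "\<forall>x\<in>A. \<forall>y\<in>A. (x, y) \<in> r \<longleftrightarrow> (f x, f y) \<in> s"
    and fin: "finite A" "finite B" and po: "partial_order_on A r" "partial_order_on B s"
    by (auto simp: poset_iso_def)
  have "s = map_prod f f ` r"
  proof (intro equalityI subrelI)
    fix x y assume xy: "(x, y) \<in> s"
    then have "x \<in> f ` A" "y \<in> f ` A"
      using partial_order_onD(4)[OF po(2)] f(1) by (auto simp: bij_betw_def)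
    then obtain a b where "x = f a" "y = f b" "a \<in> A" "b \<in> A" by blast
    then show "(x, y) \<in> map_prod f f ` r" using f(2) xy by force
  next
    fix x y assume "(x, y) \<in> map_prod f f ` r"
    then show "(x, y) \<in> s" using f(2) partial_order_onD(4)[OF po(1)] by auto
  qed
  then show thesis using that[of f] f(1) fin po by (auto simp: bij_betw_def)
qed

quotient_type poset_class = "nat set \<times> nat rel" / partial: poset_iso
proof (rule part_equivpI)
  show "\<exists>x. poset_iso x x" using poset_iso_refl[of "{}" "{}"] by auto
qed (auto intro!: sympI transpI intro: poset_iso_sym poset_iso_trans)

text \<open>The class \<open>[P]\<close> of the poset with ground set \<open>A\<close> and order relation \<open>r\<close>.\<close>

definition class_of :: "nat set \<Rightarrow> nat rel \<Rightarrow> poset_class" where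
  "class_of A r = abs_poset_class (A, r)"

lemma class_of_eq_iff:
  assumes "finite A" "partial_order_on A r" "finite B" "partial_order_on B s"
  shows "class_of A r = class_of B s \<longleftrightarrow> poset_iso (A, r) (B, s)"
  unfolding class_of_def
  using assms poset_iso_refl Quotient3_rel[OF Quotient3_poset_class] by metis

lift_definition class_size :: "poset_class \<Rightarrow> nat" is "\<lambda>(A, r). card A"
  by (auto simp: poset_iso_def dest: bij_betw_same_card)

lemma partial_order_on_Restr:
  "partial_order_on A r \<Longrightarrow> S \<subseteq> A \<Longrightarrow> partial_order_on S (Restr r S)"
  by (auto simp: partial_order_on_def preorder_on_def refl_on_def
    intro: trans_Restr antisym_subset)

lemma partial_order_on_image:
  fixes f :: "nat \<Rightarrow> nat"
  assumes "finite A" "partial_order_on A r" "inj_on f A"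
  shows "partial_order_on (f ` A) (map_prod f f ` r)"
  using poset_iso_imageI[where f = f, OF assms refl refl] by (simp add: poset_iso_def)

lemma partial_order_on_Un:
  assumes "partial_order_on A r" "partial_order_on B s" "A \<inter> B = {}"
  shows "partial_order_on (A \<union> B) (r \<union> s)"
proof -
  have r: "r \<subseteq> A \<times> A" and s: "s \<subseteq> B \<times> B"
    using assms(1,2) by (auto dest: partial_order_onD(4))
  have "trans (r \<union> s)"
  proof (rule transI)
    fix x y z assume "(x, y) \<in> r \<union> s" "(y, z) \<in> r \<union> s"
    then have "(x, y) \<in> r \<and> (y, z) \<in> r \<or> (x, y) \<in> s \<and> (y, z) \<in> s"
      using r s assms(3) by blast
    then show "(x, z) \<in> r \<union> s"
      using partial_order_onD(2)[OF assms(1)] partial_order_onD(2)[OF assms(2)]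
      by (auto elim: transE)
  qed
  moreover have "antisym (r \<union> s)"
  proof (rule antisymI)
    fix x y assume "(x, y) \<in> r \<union> s" "(y, x) \<in> r \<union> s"
    then have "(x, y) \<in> r \<and> (y, x) \<in> r \<or> (x, y) \<in> s \<and> (y, x) \<in> s"
      using r s assms(3) by blast
    then show "x = y"
      using partial_order_onD(3)[OF assms(1)] partial_order_onD(3)[OF assms(2)]
      by (auto dest: antisymD)
  qed
  moreover have "refl_on (A \<union> B) (r \<union> s)"
    using assms by (auto simp: partial_order_on_def preorder_on_def refl_on_def)
  ultimately show ?thesis using r s by (auto simp: partial_order_on_def preorder_on_def)
qed

lemma even_neq_odd: "2 * x \<noteq> Suc (2 * y)"
  by presburger

lemma map_prod_image_image:
  "map_prod f f ` map_prod g g ` r = map_prod (\<lambda>x. f (g x)) (\<lambda>x. f (g x)) ` r"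
  by (simp add: image_image map_prod_def split_def)

lemma map_prod_image_cong:
  assumes "r \<subseteq> A \<times> A" "\<And>x. x \<in> A \<Longrightarrow> f x = g x"
  shows "map_prod f f ` r = map_prod g g ` r"
  using assms by (intro image_cong) auto

text \<open>Disjoint union of posets; the ground sets are made disjoint by using even and odd numbers.\<close>

definition poset_sum :: "nat set \<times> nat rel \<Rightarrow> nat set \<times> nat rel \<Rightarrow> nat set \<times> nat rel" where
  "poset_sum = (\<lambda>(A, r) (B, s).
     ((\<lambda>x. 2 * x) ` A \<union> (\<lambda>x. 2 * x + 1) ` B,
      map_prod (\<lambda>x. 2 * x) (\<lambda>x. 2 * x) ` r \<union> map_prod (\<lambda>x. 2 * x + 1) (\<lambda>x. 2 * x + 1) ` s))"

lemma poset_sum_valid: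
  assumes "finite A" "partial_order_on A r" "finite B" "partial_order_on B s"
  shows "finite (fst (poset_sum (A, r) (B, s)))"
    "partial_order_on (fst (poset_sum (A, r) (B, s))) (snd (poset_sum (A, r) (B, s)))"
proof -
  show "finite (fst (poset_sum (A, r) (B, s)))" using assms by (simp add: poset_sum_def)
  have "(\<lambda>x. 2 * x) ` A \<inter> (\<lambda>x. 2 * x + 1) ` B = {}"
    by (auto simp: even_neq_odd even_neq_odd[symmetric])
  then show "partial_order_on (fst (poset_sum (A, r) (B, s))) (snd (poset_sum (A, r) (B, s)))"
    unfolding poset_sum_def prod.case fst_conv snd_conv
    by (intro partial_order_on_Un partial_order_on_image assms) (auto simp: inj_on_def)
qed

text \<open>To map a disjoint union onto another poset, it suffices to map the two summands.\<close>

lemma poset_iso_sumI: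
  fixes f g :: "nat \<Rightarrow> nat"
  assumes "finite A" "partial_order_on A r" "finite B" "partial_order_on B s"
    and "inj_on f A" "inj_on g B" "f ` A \<inter> g ` B = {}"
    and "C = f ` A \<union> g ` B" "t = map_prod f f ` r \<union> map_prod g g ` s"
  shows "poset_iso (poset_sum (A, r) (B, s)) (C, t)"
proof -
  define h where "h x = (if even x then f (x div 2) else g (x div 2))" for x
  have h: "h (2 * x) = f x" "h (2 * x + 1) = g x" for x by (auto simp: h_def)
  have "poset_iso (fst (poset_sum (A, r) (B, s)), snd (poset_sum (A, r) (B, s))) (C, t)"
  proof (rule poset_iso_imageI[where f = h])
    show "inj_on h (fst (poset_sum (A, r) (B, s)))"
    proof -
      have "inj_on h ((\<lambda>x. 2 * x) ` A)" "inj_on h ((\<lambda>x. 2 * x + 1) ` B)"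
        using assms(5,6) unfolding inj_on_def ball_simps(9) h by simp_all
      moreover have "h ` (\<lambda>x. 2 * x) ` A \<inter> h ` (\<lambda>x. 2 * x + 1) ` B = {}"
        using assms(7) unfolding image_image h .
      ultimately show ?thesis
        unfolding poset_sum_def prod.case fst_conv inj_on_Un by blast
    qed
    show "C = h ` fst (poset_sum (A, r) (B, s))"
      unfolding poset_sum_def prod.case fst_conv image_Un image_image h by (rule assms)
    show "t = map_prod h h ` snd (poset_sum (A, r) (B, s))"
      unfolding poset_sum_def prod.case snd_conv image_Un map_prod_image_image h by (rule assms)
  qed (use poset_sum_valid assms in blast)+
  then show ?thesis by simp
qed

lemma poset_sum_cong:
  assumes "poset_iso P P'" "poset_iso Q Q'"
  shows "poset_iso (poset_sum P Q) (poset_sum P' Q')"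
proof -
  obtain A r A' r' B s B' s' where PQ: "P = (A, r)" "P' = (A', r')" "Q = (B, s)" "Q' = (B', s')"
    by (metis surj_pair)
  from assms(1) obtain f where f: "finite A" "partial_order_on A r" "inj_on f A" "A' = f ` A"
    "r' = map_prod f f ` r" unfolding PQ by (elim poset_isoE)
  from assms(2) obtain g where g: "finite B" "partial_order_on B s" "inj_on g B" "B' = g ` B"
    "s' = map_prod g g ` s" unfolding PQ by (elim poset_isoE)
  have "poset_iso (poset_sum (A, r) (B, s))
      (fst (poset_sum P' Q'), snd (poset_sum P' Q'))"
  proof (rule poset_iso_sumI[where f = "\<lambda>x. 2 * f x" and g = "\<lambda>x. 2 * g x + 1"])
    show "(\<lambda>x. 2 * f x) ` A \<inter> (\<lambda>x. 2 * g x + 1) ` B = {}"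
      by (auto simp: even_neq_odd even_neq_odd[symmetric])
    show "fst (poset_sum P' Q') = (\<lambda>x. 2 * f x) ` A \<union> (\<lambda>x. 2 * g x + 1) ` B"
      unfolding PQ poset_sum_def prod.case fst_conv f(4) g(4) image_image ..
    show "snd (poset_sum P' Q') = map_prod (\<lambda>x. 2 * f x) (\<lambda>x. 2 * f x) ` r \<union>
        map_prod (\<lambda>x. 2 * g x + 1) (\<lambda>x. 2 * g x + 1) ` s"
      unfolding PQ poset_sum_def prod.case snd_conv f(5) g(5) map_prod_image_image ..
  qed (use f g in \<open>auto simp: inj_on_def\<close>)
  then show ?thesis by (simp add: PQ)
qed

lemma poset_sum_comm:
  assumes "poset_iso P P" "poset_iso Q Q"
  shows "poset_iso (poset_sum P Q) (poset_sum Q P)"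
proof -
  obtain A r B s where PQ: "P = (A, r)" "Q = (B, s)" by (metis surj_pair)
  have "poset_iso (poset_sum (A, r) (B, s)) (fst (poset_sum Q P), snd (poset_sum Q P))"
  proof (rule poset_iso_sumI[where f = "\<lambda>x. 2 * x + 1" and g = "\<lambda>x. 2 * x"])
    show "(\<lambda>x. 2 * x + 1) ` A \<inter> (\<lambda>x. 2 * x) ` B = {}"
      by (auto simp: even_neq_odd even_neq_odd[symmetric])
  qed (use assms in \<open>auto simp: PQ poset_iso_def inj_on_def poset_sum_def\<close>)
  then show ?thesis by (simp add: PQ)
qed

lemma poset_sum_assoc:
  assumes "poset_iso P P" "poset_iso Q Q" "poset_iso R R"
  shows "poset_iso (poset_sum (poset_sum P Q) R) (poset_sum P (poset_sum Q R))"
proof -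
  obtain A r B s C t where PQR: "P = (A, r)" "Q = (B, s)" "R = (C, t)" by (metis surj_pair)
  have A: "finite A" "partial_order_on A r" and B: "finite B" "partial_order_on B s"
    and C: "finite C" "partial_order_on C t" using assms by (auto simp: PQR poset_iso_def)
  define f :: "nat \<Rightarrow> nat"
    where "f x = (if even x then x else 4 * (x div 2) + 1)" for x
  have f: "f (2 * x) = 2 * x" "f (2 * x + 1) = 4 * x + 1" for x by (auto simp: f_def)
  let ?D = "fst (poset_sum P Q)" and ?u = "snd (poset_sum P Q)"
  have "poset_iso (poset_sum (?D, ?u) (C, t))
      (fst (poset_sum P (poset_sum Q R)), snd (poset_sum P (poset_sum Q R)))"
  proof (rule poset_iso_sumI[where f = f and g = "\<lambda>x. 4 * x + 3"])
    show "finite ?D" "partial_order_on ?D ?u" using poset_sum_valid[OF A B] by (simp_all add: PQR)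
    have "x = y" if "f x = f y" for x y
      using that unfolding f_def by (cases "even x"; cases "even y"; simp; presburger)
    then show "inj_on f ?D" by (auto simp: inj_on_def)
    show "f ` ?D \<inter> (\<lambda>x. 4 * x + 3) ` C = {}"
    proof -
      have "f x \<noteq> 4 * y + 3" for x y
      proof (cases "even x")
        case True
        then have "even (f x)" by (simp add: f_def)
        then show ?thesis by auto
      next
        case False
        then have "f x mod 4 = 1" by (simp add: f_def mod_Suc)
        then show ?thesis by presburger
      qed
      then show ?thesis by auto
    qed
    have eq: "2 * (2 * x) + 1 = 4 * x + (1::nat)" "2 * (2 * x + 1) + 1 = 4 * x + (3::nat)" for x
      by simp_all
    show "fst (poset_sum P (poset_sum Q R)) = f ` ?D \<union> (\<lambda>x. 4 * x + 3) ` C"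
      unfolding PQR poset_sum_def prod.case fst_conv image_Un image_image f eq Un_assoc ..
    show "snd (poset_sum P (poset_sum Q R)) =
        map_prod f f ` ?u \<union> map_prod (\<lambda>x. 4 * x + 3) (\<lambda>x. 4 * x + 3) ` t"
      unfolding PQR poset_sum_def prod.case snd_conv image_Un map_prod_image_image f eq Un_assoc ..
  qed (use C in \<open>auto simp: inj_on_def\<close>)
  then show ?thesis by (simp add: PQR)
qed

lemma poset_sum_empty:
  assumes "poset_iso P P"
  shows "poset_iso (poset_sum ({}, {}) P) P"
proof -
  obtain A r where P: "P = (A, r)" by (metis surj_pair)
  have "poset_iso (poset_sum ({}, {}) (A, r)) (A, r)"
    by (rule poset_iso_sumI[where f = id and g = id])
      (use assms in \<open>auto simp: P poset_iso_def map_prod.id\<close>)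
  then show ?thesis by (simp add: P)
qed

instantiation poset_class :: comm_monoid_add
begin

lift_definition zero_poset_class :: poset_class is "({}, {})"
  by (rule poset_iso_refl) auto

lift_definition plus_poset_class :: "poset_class \<Rightarrow> poset_class \<Rightarrow> poset_class" is poset_sum
  by (rule poset_sum_cong)

instance
proof
  fix a b c :: poset_class
  show "a + b + c = a + (b + c)" by transfer (rule poset_sum_assoc)
  show "a + b = b + a" by transfer (rule poset_sum_comm)
  show "0 + a = a" by transfer (rule poset_sum_empty)
qed

end

text \<open>
  \<open>(x, y) \<in> hasse A r\<close> iff \<open>y\<close> covers \<open>x\<close>, i.e. the Hasse diagram has an edge between \<open>x\<close> and \<open>y\<close>.
\<close>

definition hasse :: "nat set \<Rightarrow> nat rel \<Rightarrow> nat rel" where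
  "hasse A r = {(x, y). (x, y) \<in> r \<and> x \<noteq> y \<and>
     \<not> (\<exists>z\<in>A. z \<noteq> x \<and> z \<noteq> y \<and> (x, z) \<in> r \<and> (z, y) \<in> r)}"

definition components :: "nat set \<Rightarrow> nat rel \<Rightarrow> nat set set" where
  "components A r = A // (hasse A r \<union> (hasse A r)\<inverse>)\<^sup>*"

lemma rtrancl_image:
  assumes "R \<subseteq> A \<times> A" "inj_on f A" "x \<in> A"
  shows "(map_prod f f ` R)\<^sup>* `` {f x} = f ` (R\<^sup>* `` {x})"
proof (intro equalityI subsetI)
  fix y assume "y \<in> (map_prod f f ` R)\<^sup>* `` {f x}"
  then have "(f x, y) \<in> (map_prod f f ` R)\<^sup>*" by simp
  then have "\<exists>z\<in>A. y = f z \<and> (x, z) \<in> R\<^sup>*"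
  proof (induction rule: rtrancl_induct)
    case base
    then show ?case using assms(3) by blast
  next
    case (step y w)
    then obtain z where z: "z \<in> A" "y = f z" "(x, z) \<in> R\<^sup>*" by blast
    from step.hyps(2) obtain a b where ab: "(a, b) \<in> R" "y = f a" "w = f b" by auto
    then have "a = z" using z assms(1,2) by (auto dest: inj_onD)
    then have "(x, b) \<in> R\<^sup>*" using z(3) ab(1) by (meson rtrancl_into_rtrancl)
    then show ?case using ab assms(1) by blast
  qed
  then show "y \<in> f ` (R\<^sup>* `` {x})" by blast
next
  fix y assume "y \<in> f ` (R\<^sup>* `` {x})"
  then obtain z where "y = f z" and "(x, z) \<in> R\<^sup>*" by blast
  from this(2) have "(f x, f z) \<in> (map_prod f f ` R)\<^sup>*"
    by (induction rule: rtrancl_induct) (auto intro: rtrancl_into_rtrancl)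
  then show "y \<in> (map_prod f f ` R)\<^sup>* `` {f x}" using \<open>y = f z\<close> by simp
qed

lemma hasse_image:
  assumes "r \<subseteq> A \<times> A" "inj_on f A"
  shows "hasse (f ` A) (map_prod f f ` r) = map_prod f f ` hasse A r"
proof -
  have mem: "(f x, f y) \<in> map_prod f f ` r \<longleftrightarrow> (x, y) \<in> r" if "x \<in> A" "y \<in> A" for x y
    using that assms by (auto dest: inj_onD)
  have eq: "f x = f y \<longleftrightarrow> x = y" if "x \<in> A" "y \<in> A" for x y
    using that assms(2) by (auto dest: inj_onD)
  have key: "(f x, f y) \<in> hasse (f ` A) (map_prod f f ` r) \<longleftrightarrow> (x, y) \<in> hasse A r"
    if "x \<in> A" "y \<in> A" for x y
    unfolding hasse_def using that by (simp add: mem eq)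
  show ?thesis
  proof (intro equalityI subrelI)
    fix u v assume uv: "(u, v) \<in> hasse (f ` A) (map_prod f f ` r)"
    then obtain x y where "u = f x" "v = f y" "(x, y) \<in> r" by (auto simp: hasse_def)
    moreover from this have "(x, y) \<in> hasse A r" using key uv assms(1) by blast
    ultimately show "(u, v) \<in> map_prod f f ` hasse A r" by force
  next
    fix u v assume "(u, v) \<in> map_prod f f ` hasse A r"
    then obtain x y where "u = f x" "v = f y" "(x, y) \<in> hasse A r" by auto
    moreover from this have "x \<in> A" "y \<in> A" using assms(1) by (auto simp: hasse_def)
    ultimately show "(u, v) \<in> hasse (f ` A) (map_prod f f ` r)" using key by blast
  qed
qed

lemma card_components_image:
  assumes "r \<subseteq> A \<times> A" "inj_on f A"
  shows "card (components (f ` A) (map_prod f f ` r)) = card (components A r)"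
proof -
  let ?R = "hasse A r \<union> (hasse A r)\<inverse>"
  have sub: "?R \<subseteq> A \<times> A" using assms(1) by (auto simp: hasse_def)
  have R: "hasse (f ` A) (map_prod f f ` r) \<union> (hasse (f ` A) (map_prod f f ` r))\<inverse> =
      map_prod f f ` ?R"
    unfolding hasse_image[OF assms] by (auto simp: image_Un)
  have "components (f ` A) (map_prod f f ` r) = (\<lambda>x. f ` (?R\<^sup>* `` {x})) ` A"
    unfolding components_def R quotient_def
    using rtrancl_image[OF sub assms(2)] by auto
  also have "\<dots> = image f ` components A r"
    by (auto simp: components_def quotient_def)
  finally have "components (f ` A) (map_prod f f ` r) = image f ` components A r" .
  moreover have "components A r \<subseteq> Pow A"
  proof -
    have "y \<in> A" if "(x, y) \<in> ?R\<^sup>*" "x \<in> A" for x y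
      using that by (induction rule: rtrancl_induct) (use sub in auto)
    then show ?thesis unfolding components_def quotient_def by blast
  qed
  then have "inj_on (image f) (components A r)"
    using assms(2) by (meson inj_on_image_Pow inj_on_subset)
  ultimately show ?thesis by (simp add: card_image)
qed

lift_definition rk :: "poset_class \<Rightarrow> nat" is "\<lambda>(A, r). card A - card (components A r)"
  by (auto elim!: poset_isoE simp: card_image
    intro!: arg_cong2[where f = minus] card_components_image[symmetric] dest: partial_order_onD(4))

definition poset_ideal :: "nat set \<Rightarrow> nat rel \<Rightarrow> nat set \<Rightarrow> bool" where
  "poset_ideal A r S \<longleftrightarrow> S \<subseteq> A \<and> \<not> (\<exists>x\<in>A - S. \<exists>y\<in>S. (x, y) \<in> r)"

lemma class_of_Restr_image:
  assumes "finite A" "partial_order_on A r" "inj_on f A" "S \<subseteq> A"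
  shows "class_of (f ` S) (Restr (map_prod f f ` r) (f ` S)) = class_of S (Restr r S)"
proof -
  have sub: "r \<subseteq> A \<times> A" using assms(2) by (rule partial_order_onD(4))
  have S: "finite S" "partial_order_on S (Restr r S)" "inj_on f S"
    using assms by (auto intro: finite_subset partial_order_on_Restr inj_on_subset)
  have "Restr (map_prod f f ` r) (f ` S) = map_prod f f ` Restr r S"
  proof (intro equalityI subrelI)
    fix u v assume "(u, v) \<in> Restr (map_prod f f ` r) (f ` S)"
    then obtain x y a b where "(x, y) \<in> r" "u = f x" "v = f y" "a \<in> S" "b \<in> S" "u = f a" "v = f b"
      by auto
    moreover from this have "a \<in> A" "b \<in> A" "x \<in> A" "y \<in> A" using sub assms(4) by auto
    ultimately have "a = x" "b = y" using assms(3) by (metis inj_onD)+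
    moreover note \<open>a \<in> S\<close> \<open>b \<in> S\<close> \<open>(x, y) \<in> r\<close> \<open>u = f x\<close> \<open>v = f y\<close>
    ultimately show "(u, v) \<in> map_prod f f ` Restr r S" by force
  qed auto
  then have "poset_iso (S, Restr r S) (f ` S, Restr (map_prod f f ` r) (f ` S))"
    using S by (intro poset_iso_imageI[where f = f]) auto
  then show ?thesis
    using S class_of_eq_iff[of S "Restr r S" "f ` S" "Restr (map_prod f f ` r) (f ` S)"]
    by (auto simp: poset_iso_def)
qed

lemma poset_ideal_image:
  assumes "r \<subseteq> A \<times> A" "inj_on f A"
  shows "{T. poset_ideal (f ` A) (map_prod f f ` r) T} = image f ` {S. poset_ideal A r S}"
proof -
  have mem: "(f x, f y) \<in> map_prod f f ` r \<longleftrightarrow> (x, y) \<in> r" if "x \<in> A" "y \<in> A" for x y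
    using that assms by (auto dest: inj_onD)
  have key: "poset_ideal (f ` A) (map_prod f f ` r) (f ` S) \<longleftrightarrow> poset_ideal A r S" if "S \<subseteq> A" for S
  proof -
    have "f ` A - f ` S = f ` (A - S)" using that assms(2) by (simp add: inj_on_image_set_diff)
    then show ?thesis unfolding poset_ideal_def using that
      by (auto simp: mem subset_iff inj_on_image_mem_iff[OF assms(2)])
  qed
  show ?thesis
  proof (intro equalityI subsetI)
    fix T assume T: "T \<in> {T. poset_ideal (f ` A) (map_prod f f ` r) T}"
    then obtain S where "S \<subseteq> A" "T = f ` S" by (auto simp: poset_ideal_def subset_image_iff)
    then show "T \<in> image f ` {S. poset_ideal A r S}" using T key by blast
  next
    fix T assume "T \<in> image f ` {S. poset_ideal A r S}"
    then obtain S where "T = f ` S" "poset_ideal A r S" by blast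
    then show "T \<in> {T. poset_ideal (f ` A) (map_prod f f ` r) T}"
      using key[of S] by (simp add: poset_ideal_def)
  qed
qed

definition ideal_sum :: "nat set \<Rightarrow> nat rel \<Rightarrow> (poset_class \<times> poset_class \<Rightarrow>\<^sub>0 'c::field)" where
  "ideal_sum A r = (\<Sum>S | poset_ideal A r S.
     basis (class_of S (Restr r S), class_of (A - S) (Restr r (A - S))))"

lemma ideal_sum_image:
  assumes "finite A" "partial_order_on A r" "inj_on f A"
  shows "ideal_sum (f ` A) (map_prod f f ` r) = ideal_sum A r"
proof -
  have sub: "r \<subseteq> A \<times> A" using assms(2) by (rule partial_order_onD(4))
  have inj: "inj_on (image f) {S. poset_ideal A r S}"
    using inj_on_image_Pow[OF assms(3)] by (rule inj_on_subset) (auto simp: poset_ideal_def)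
  show ?thesis
    unfolding ideal_sum_def poset_ideal_image[OF sub assms(3)] sum.reindex[OF inj] o_def
  proof (rule sum.cong[OF refl])
    fix S assume "S \<in> {S. poset_ideal A r S}"
    then have S: "S \<subseteq> A" by (simp add: poset_ideal_def)
    have diff: "f ` A - f ` S = f ` (A - S)"
      using S assms(3) by (simp add: inj_on_image_set_diff)
    show "basis (class_of (f ` S) (Restr (map_prod f f ` r) (f ` S)),
        class_of (f ` A - f ` S) (Restr (map_prod f f ` r) (f ` A - f ` S))) =
      basis (class_of S (Restr r S), class_of (A - S) (Restr r (A - S)))"
      unfolding diff class_of_Restr_image[OF assms S] class_of_Restr_image[OF assms Diff_subset] ..
  qed
qed

lift_definition class_comult :: "poset_class \<Rightarrow> (poset_class \<times> poset_class \<Rightarrow>\<^sub>0 'c::field)" is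
  "\<lambda>(A, r). ideal_sum A r"
  by (auto elim!: poset_isoE simp: ideal_sum_image)


section \<open>The Hopf algebra of posets\<close>

text \<open>
  Since \<open>poset_class\<close> is a commutative monoid under disjoint union, the library makes
  \<open>poset_class \<Rightarrow>\<^sub>0 'c\<close> its monoid algebra: \<open>basis a * basis b = basis (a + b)\<close>, with unit the class
  of the empty poset.
\<close>

type_synonym 'c poset_alg = "poset_class \<Rightarrow>\<^sub>0 'c"

definition poset_comult :: "'c::field poset_alg \<Rightarrow> (poset_class \<times> poset_class \<Rightarrow>\<^sub>0 'c)" where
  "poset_comult = lin_ext class_comult"

definition poset_counit :: "'c::field poset_alg \<Rightarrow> 'c" where
  "poset_counit = lin_form (\<lambda>p. if p = 0 then 1 else 0)"

definition poset_homogeneous :: "nat \<Rightarrow> 'c::field poset_alg set" where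
  "poset_homogeneous n = {x. \<forall>p\<in>Poly_Mapping.keys x. class_size p = n}"

definition zeta_q :: "'k::field poly fract poset_alg \<Rightarrow> 'k poly fract" where
  "zeta_q = lin_form (\<lambda>p. qvar ^ rk p)"


section \<open>The universal morphism\<close>

text \<open>
  A morphism of graded Hopf algebras from posets to QSym: a linear map of degree \<open>0\<close> compatible with
  products, units, coproducts and counits. Compatibility with the antipodes is then automatic.
  The product of QSym being that of power series, multiplicativity is stated for the latter.
\<close>

definition graded_hopf_morphism :: "('c::field poset_alg \<Rightarrow> 'c qsym) \<Rightarrow> bool" where
  "graded_hopf_morphism F \<longleftrightarrow>
     Vector_Spaces.linear scale scale F \<and>
     (\<forall>n. \<forall>x\<in>poset_homogeneous n. F x \<in> qsym_homogeneous n) \<and>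
     F 1 = qsym_unit \<and>
     (\<forall>x y. qsym_series (F (x * y)) = series_mult (qsym_series (F x)) (qsym_series (F y))) \<and>
     (\<forall>x. qsym_comult (F x) = tensor_map F (poset_comult x)) \<and>
     (\<forall>x. qsym_counit (F x) = poset_counit x)"

text \<open>The description operator is justified by the theorem of Aguiar, Bergeron and Sottile.\<close>

definition Psi_q :: "'k::field poly fract poset_alg \<Rightarrow> 'k poly fract qsym" where
  "Psi_q = (THE F. graded_hopf_morphism F \<and> (\<forall>x. zeta_Q (F x) = zeta_q x))"

end

theory Submission
  imports Defs
begin

text \<open>
  The coefficient of \<open>M\<^sub>\<alpha>\<close> with \<open>\<alpha> = a \<cdot> \<beta>\<close> can be read off the coproduct at \<open>M\<^sub>a \<otimes> M\<^sub>\<beta>\<close>, and the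
  coefficient of \<open>M\<^sub>a\<close> is a value of the character. Hence the coefficient of \<open>M\<^sub>\<alpha>\<close> in \<open>\<Psi>\<^sub>q([P])\<close> must be
  the sum over chains of ideals with differences of sizes \<open>\<alpha>\<^sub>1, \<alpha>\<^sub>2, \<dots>\<close> of the product of \<open>q\<close> to the
  ranks of the differences; conversely these coefficients define a morphism. A chain of ideals is an
  order-preserving map read off by its fibres, so the series of \<open>\<Psi>\<^sub>q([P])\<close> is the sum over order-preserving \<open>f : [n] \<rightarrow> {1, 2, \<dots>}\<close> of the monomial of \<open>f\<close>
  times \<open>q\<close> to the sum of the ranks of the fibres; in this form multiplicativity is evident.

  On the geometric side, \<open>\<omega>\<close> is bounded above on \<open>C(P)\<close> iff it is order-preserving, and its face of
  maximizers is then the cone of the relations \<open>i <\<^sub>P j\<close> with \<open>\<omega>\<^sub>i = \<omega>\<^sub>j\<close>. The span of the differences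
  \<open>e\<^sub>i - e\<^sub>j\<close> along the edges of a graph has dimension the number of vertices minus the number of components, so
  the dimension of this face is the sum of the ranks of the fibres of \<open>\<omega>\<close>.
\<close>

section \<open>Chains of ideals and the universal morphism\<close>

lemma lin_form_superset:
  assumes "finite S" "Poly_Mapping.keys x \<subseteq> S"
  shows "lin_form f x = (\<Sum>a\<in>S. Poly_Mapping.lookup x a * f a)"
  unfolding lin_form_def
  by (rule sum.mono_neutral_left[OF assms]) (auto simp: in_keys_iff)

lemma lin_form_add: "lin_form f (x + y) = lin_form f x + lin_form f y"
proof -
  let ?S = "Poly_Mapping.keys x \<union> Poly_Mapping.keys y"
  have "lin_form f z = (\<Sum>a\<in>?S. Poly_Mapping.lookup z a * f a)"
    if "Poly_Mapping.keys z \<subseteq> ?S" for z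
    by (rule lin_form_superset) (use that in auto)
  then show ?thesis
    using keys_add[of x y] by (simp add: lookup_add sum.distrib algebra_simps)
qed

lemma lin_form_zero [simp]: "lin_form f 0 = 0"
  by (simp add: lin_form_def)

lemma lin_form_scale: "lin_form f (scale c x) = c * lin_form f x"
proof -
  have "lin_form f (scale c x) =
      (\<Sum>a\<in>Poly_Mapping.keys x. Poly_Mapping.lookup (scale c x) a * f a)"
    by (rule lin_form_superset) (auto simp: in_keys_iff)
  then show ?thesis by (simp add: lin_form_def sum_distrib_left mult.assoc)
qed

lemma lin_form_sum: "lin_form f (sum g S) = (\<Sum>s\<in>S. lin_form f (g s))"
  by (induction S rule: infinite_finite_induct) (auto simp: lin_form_add)

lemma lin_form_basis [simp]: "lin_form f (basis a) = f a"
  by (simp add: lin_form_def basis_def)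

text \<open>A coordinate is itself a linear form. This reduces the coproduct, counit and character
  of QSym to single coefficients.\<close>

lemma lin_form_delta: "lin_form (\<lambda>a. if a = b then 1 else 0) x = Poly_Mapping.lookup x b"
  by (simp add: lin_form_def sum.delta in_keys_iff if_distrib cong: if_cong)

lemma lookup_basis: "Poly_Mapping.lookup (basis a) b = (if a = b then 1 else 0)"
  by (simp add: basis_def lookup_single when_def)

lemma lookup_lin_ext:
  "Poly_Mapping.lookup (lin_ext f x) b = lin_form (\<lambda>a. Poly_Mapping.lookup (f a) b) x"
  by (simp add: lin_ext_def lin_form_def lookup_sum)

lemma lin_ext_basis [simp]: "lin_ext f (basis a) = f a"
  by (rule poly_mapping_eqI) (simp add: lookup_lin_ext)

lemma linear_lin_ext: "Vector_Spaces.linear scale scale (lin_ext f)"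
  unfolding Vector_Spaces.linear_def module_hom_def module_hom_axioms_def
  by (auto simp: module_iff_vector_space lookup_lin_ext lin_form_add
      lin_form_scale lookup_add intro!: poly_mapping_eqI vector_space_scale)

lemma eq_sum_scale_basis:
  "x = (\<Sum>a\<in>Poly_Mapping.keys x. scale (Poly_Mapping.lookup x a) (basis a))"
  by (rule poly_mapping_eqI) (simp add: lookup_sum lookup_basis in_keys_iff if_distrib cong: if_cong)

text \<open>Linear maps are determined on the basis; this turns uniqueness of the morphism into a
  statement about classes of posets.\<close>

lemma linear_eq_lin_ext:
  assumes "Vector_Spaces.linear scale scale F"
  shows "F = lin_ext (\<lambda>a. F (basis a))"
proof
  fix x
  interpret F: Vector_Spaces.linear scale scale F by fact
  have "F x = F (\<Sum>a\<in>Poly_Mapping.keys x. scale (Poly_Mapping.lookup x a) (basis a))"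
    using eq_sum_scale_basis[of x] by simp
  also have "\<dots> = lin_ext (\<lambda>a. F (basis a)) x"
    by (simp add: lin_ext_def F.sum F.scale)
  finally show "F x = lin_ext (\<lambda>a. F (basis a)) x" .
qed

lemma lookup_tensor:
  "Poly_Mapping.lookup (tensor u v) (a, b) = Poly_Mapping.lookup u a * Poly_Mapping.lookup v b"
proof -
  have "Poly_Mapping.lookup (tensor u v) (a, b) =
      (\<Sum>a'\<in>Poly_Mapping.keys u. \<Sum>b'\<in>Poly_Mapping.keys v.
        if a' = a then if b' = b then Poly_Mapping.lookup u a' * Poly_Mapping.lookup v b' else 0 else 0)"
    by (auto simp: tensor_def lookup_sum lookup_single when_def intro!: sum.cong)
  also have "\<dots> = (\<Sum>a'\<in>Poly_Mapping.keys u. if a' = a then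
      (\<Sum>b'\<in>Poly_Mapping.keys v. if b' = b then Poly_Mapping.lookup u a' * Poly_Mapping.lookup v b' else 0) else 0)"
    by (intro sum.cong) auto
  finally show ?thesis by (auto simp: sum.delta in_keys_iff)
qed

text \<open>Reduces equations between tensors to scalar equations, each side being a linear form in
  \<open>t\<close>.\<close>

lemma lookup_tensor_map:
  "Poly_Mapping.lookup (tensor_map F t) (b, c) =
    lin_form (\<lambda>(x, y). Poly_Mapping.lookup (F (basis x)) b * Poly_Mapping.lookup (F (basis y)) c) t"
  unfolding tensor_map_def lookup_lin_ext
  by (rule arg_cong[where f = "\<lambda>g. lin_form g t"]) (auto simp: lookup_tensor)

section \<open>Compositions and the coproduct of QSym\<close>

lemma parts_pos: "a \<in> set (parts \<alpha>) \<Longrightarrow> a > 0"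
  using parts[of \<alpha>] by auto

lemma parts_composition: "\<forall>a\<in>set as. a > 0 \<Longrightarrow> parts (composition as) = as"
  by (rule composition_inverse) simp

text \<open>The only basis element whose coproduct contains a given pair is the one indexed by the
  concatenation of the pair.\<close>

lemma lookup_qsym_comult:
  "Poly_Mapping.lookup (qsym_comult f) (\<beta>, \<gamma>) =
    Poly_Mapping.lookup f (composition (parts \<beta> @ parts \<gamma>))"
proof -
  \<comment> \<open>A sum over an infinite set would be 0 by convention. A splitting of
    \<open>as\<close> is determined by its cut position.\<close>
  have fin: "finite {(\<beta>, \<gamma>). parts \<beta> @ parts \<gamma> = as}" for as
  proof (rule finite_imageD)
    show "finite ((\<lambda>(\<beta>, \<gamma>). (parts \<beta>, parts \<gamma>)) ` {(\<beta>, \<gamma>). parts \<beta> @ parts \<gamma> = as})"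
    proof (rule finite_subset[where B = "(\<lambda>k. (take k as, drop k as)) ` {..length as}"])
      have "(bs, cs) \<in> (\<lambda>k. (take k as, drop k as)) ` {..length as}" if "bs @ cs = as" for bs cs
        using that by (intro image_eqI[where x = "length bs"]) auto
      then show "(\<lambda>(\<beta>, \<gamma>). (parts \<beta>, parts \<gamma>)) ` {(\<beta>, \<gamma>). parts \<beta> @ parts \<gamma> = as} \<subseteq>
          (\<lambda>k. (take k as, drop k as)) ` {..length as}"
        by auto
    qed simp
  qed (auto simp: inj_on_def parts_inject)
  have "Poly_Mapping.lookup (\<Sum>(\<beta>, \<gamma>) | parts \<beta> @ parts \<gamma> = parts \<alpha>. basis (\<beta>, \<gamma>)) (\<beta>, \<gamma>) =
      (if \<alpha> = composition (parts \<beta> @ parts \<gamma>) then 1 else (0::'a))" for \<alpha>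
  proof -
    have "Poly_Mapping.lookup (\<Sum>(\<beta>, \<gamma>) | parts \<beta> @ parts \<gamma> = parts \<alpha>. basis (\<beta>, \<gamma>)) (\<beta>, \<gamma>) =
       (\<Sum>x | parts (fst x) @ parts (snd x) = parts \<alpha>. if x = (\<beta>, \<gamma>) then 1 else (0::'a))"
      unfolding lookup_sum by (intro sum.cong) (auto simp: lookup_basis)
    also have "\<dots> = (if parts \<beta> @ parts \<gamma> = parts \<alpha> then 1 else 0)"
      using fin[of "parts \<alpha>"] by (simp add: case_prod_unfold)
    also have "parts \<beta> @ parts \<gamma> = parts \<alpha> \<longleftrightarrow> \<alpha> = composition (parts \<beta> @ parts \<gamma>)"
      using parts_composition[of "parts \<beta> @ parts \<gamma>"] parts_pos
      by (metis parts_inverse Un_iff set_append)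
    finally show ?thesis .
  qed
  then show ?thesis
    unfolding qsym_comult_def lookup_lin_ext by (simp add: lin_form_delta)
qed

text \<open>Positive parts bound both the entries and the length by \<open>n\<close>.\<close>

lemma finite_compositions_of: "finite {\<alpha>. sum_list (parts \<alpha>) = n}"
proof (rule finite_imageD)
  have "length as \<le> sum_list as" if "\<forall>a\<in>set as. a > 0" for as :: "nat list"
    using that by (induction as) auto
  then have "parts ` {\<alpha>. sum_list (parts \<alpha>) = n} \<subseteq> {as. set as \<subseteq> {..n} \<and> length as \<le> n}"
    using parts_pos member_le_sum_list by (fastforce simp: subset_iff)
  then show "finite (parts ` {\<alpha>. sum_list (parts \<alpha>) = n})"
    by (rule finite_subset) (simp add: finite_lists_length_le)
qed (auto simp: inj_on_def parts_inject)

section \<open>Isomorphism classes and their ideals\<close>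

text \<open>The quotient is partial, so its induction rule supplies a pair related to itself, and
  such a pair is a finite poset.\<close>

lemma poset_class_cases:
  obtains A r where "finite A" "partial_order_on A r" "p = class_of A r"
proof -
  have "\<exists>A r. finite A \<and> partial_order_on A r \<and> p = class_of A r"
    by (induction p rule: poset_class.abs_induct) (auto simp: class_of_def poset_iso_def)
  then show thesis using that by blast
qed

lemma class_size_class_of:
  assumes "finite A" "partial_order_on A r"
  shows "class_size (class_of A r) = card A"
  using class_size.abs_eq[OF poset_iso_refl[OF assms]] by (simp add: class_of_def)

lemma class_of_empty: "class_of {} r = 0" if "partial_order_on {} r"
  using that partial_order_onD(4)[OF that] by (simp add: class_of_def zero_poset_class.abs_eq)

lemma class_of_eq_0_iff:
  assumes "finite A" "partial_order_on A r"
  shows "class_of A r = 0 \<longleftrightarrow> A = {}"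
  using assms class_size_class_of[OF assms] class_size_class_of[of "{}" "{}"] class_of_empty
  by (metis card_0_eq card.empty class_of_empty finite.emptyI partial_order_on_empty)

lemma class_comult_class_of:
  assumes "finite A" "partial_order_on A r"
  shows "class_comult (class_of A r) = ideal_sum A r"
  using class_comult.abs_eq[OF poset_iso_refl[OF assms]] by (simp add: class_of_def)

text \<open>All pieces cut out of one poset are described by subsets of its fixed ground set, so
  recursions over classes become recursions over sets.\<close>

abbreviation subposet_class :: "nat rel \<Rightarrow> nat set \<Rightarrow> poset_class" where
  "subposet_class r S \<equiv> class_of S (Restr r S)"

lemma poset_ideal_Restr [simp]: "poset_ideal S (Restr r S) T \<longleftrightarrow> poset_ideal S r T"
  by (auto simp: poset_ideal_def)

lemma poset_ideal_subset: "poset_ideal A r S \<Longrightarrow> S \<subseteq> A"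
  by (simp add: poset_ideal_def)

lemma Restr_Restr: "T \<subseteq> S \<Longrightarrow> Restr (Restr r S) T = Restr r T"
  by auto

lemma finite_poset_ideals: "finite A \<Longrightarrow> finite {S. poset_ideal A r S}"
  by (rule finite_subset[of _ "Pow A"]) (auto simp: poset_ideal_def)

lemma Restr_ground: "partial_order_on A r \<Longrightarrow> Restr r A = r"
  using partial_order_onD(4) by blast

lemma class_comult_subposet:
  assumes "finite A" "partial_order_on A r" "B \<subseteq> A"
  shows "class_comult (subposet_class r B) =
    (\<Sum>S | poset_ideal B r S. basis (subposet_class r S, subposet_class r (B - S)))"
proof -
  have "finite B" "partial_order_on B (Restr r B)"
    using assms by (auto intro: finite_subset partial_order_on_Restr)
  then show ?thesis
    unfolding class_comult_class_of[OF \<open>finite B\<close> \<open>partial_order_on B (Restr r B)\<close>] ideal_sum_def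
    by (intro sum.cong) (auto simp only: poset_ideal_Restr poset_ideal_subset Restr_Restr Diff_subset)
qed

lemma subposet_size:
  assumes "finite A" "partial_order_on A r" "B \<subseteq> A"
  shows "class_size (subposet_class r B) = card B"
  using assms by (intro class_size_class_of) (auto intro: finite_subset partial_order_on_Restr)

lemma subposet_eq_0_iff:
  assumes "finite A" "partial_order_on A r" "B \<subseteq> A"
  shows "subposet_class r B = 0 \<longleftrightarrow> B = {}"
  using assms by (intro class_of_eq_0_iff) (auto intro: finite_subset partial_order_on_Restr)

text \<open>
  The coefficient of \<open>M\<^sub>\<alpha>\<close> in the image of \<open>p\<close>: the sum over the chains of ideals of \<open>p\<close> with
  successive differences of sizes \<open>\<alpha>\<^sub>1, \<alpha>\<^sub>2, \<dots>\<close> of the product of the characters of these differences.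
\<close>

primrec chain_coeff :: "nat list \<Rightarrow> poset_class \<Rightarrow> 'k::field poly fract" where
  "chain_coeff [] p = (if p = 0 then 1 else 0)"
| "chain_coeff (a # as) p = lin_form
     (\<lambda>(s, t). if class_size s = a then qvar ^ rk s * chain_coeff as t else 0) (class_comult p)"

section \<open>Recursion, homogeneity and deconcatenation of the chain coefficients\<close>

lemma chain_coeff_Cons_subposet:
  assumes "finite A" "partial_order_on A r" "B \<subseteq> A"
  shows "chain_coeff (a # as) (subposet_class r B) =
    (\<Sum>S | poset_ideal B r S \<and> card S = a.
      qvar ^ rk (subposet_class r S) * chain_coeff as (subposet_class r (B - S)))"
proof -
  have fin: "finite {S. poset_ideal B r S}"
    using assms by (intro finite_poset_ideals) (auto intro: finite_subset)
  have size: "class_size (subposet_class r S) = card S" if "poset_ideal B r S" for S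
    using that assms by (intro subposet_size[OF assms(1,2)]) (auto simp: poset_ideal_def)
  have "chain_coeff (a # as) (subposet_class r B) = (\<Sum>S | poset_ideal B r S.
      if card S = a then qvar ^ rk (subposet_class r S) * chain_coeff as (subposet_class r (B - S)) else 0)"
    unfolding chain_coeff.simps class_comult_subposet[OF assms] lin_form_sum lin_form_basis prod.case
    by (rule sum.cong) (auto simp: size)
  then show ?thesis
    by (simp only: sum.inter_filter[OF fin, symmetric] mem_Collect_eq)
qed

text \<open>A nonzero sum has a nonzero term, hence a first block of size \<open>a\<close> whose
  complement again has a nonzero coefficient; the block sizes add up to the size of
  \<open>B\<close>.\<close>

lemma chain_coeff_nonzero:
  assumes "finite A" "partial_order_on A r" "B \<subseteq> A"
    "chain_coeff as (subposet_class r B) \<noteq> (0 :: 'a::field poly fract)"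
  shows "sum_list as = card B"
  using assms(3,4)
proof (induction as arbitrary: B)
  case Nil
  then show ?case using subposet_eq_0_iff[OF assms(1,2) Nil(1)] by (auto split: if_splits)
next
  case (Cons a as)
  have "\<exists>S. poset_ideal B r S \<and> card S = a \<and>
      chain_coeff as (subposet_class r (B - S)) \<noteq> (0 :: 'a poly fract)"
  proof (rule ccontr)
    assume "\<nexists>S. poset_ideal B r S \<and> card S = a \<and>
      chain_coeff as (subposet_class r (B - S)) \<noteq> (0 :: 'a poly fract)"
    then have "chain_coeff (a # as) (subposet_class r B) = (0 :: 'a poly fract)"
      unfolding chain_coeff_Cons_subposet[OF assms(1,2) Cons.prems(1)]
      by (intro sum.neutral) auto
    then show False using Cons.prems(2) by simp
  qed
  then obtain S where S: "poset_ideal B r S" "card S = a"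
      "chain_coeff as (subposet_class r (B - S)) \<noteq> (0 :: 'a poly fract)"
    by blast
  have "B - S \<subseteq> A" using Cons.prems by auto
  from Cons.IH[OF this S(3)] have "sum_list as = card (B - S)" .
  moreover have "S \<subseteq> B" "finite B" using S(1) Cons.prems assms(1)
    by (auto simp: poset_ideal_def intro: finite_subset)
  ultimately show ?case
    using S(2) card_mono[OF \<open>finite B\<close> \<open>S \<subseteq> B\<close>] by (simp add: card_Diff_subset finite_subset)
qed

lemma chain_coeff_size:
  assumes "chain_coeff as p \<noteq> (0 :: 'a::field poly fract)"
  shows "sum_list as = class_size p"
proof -
  obtain A r where A: "finite A" "partial_order_on A r" "p = class_of A r"
    by (rule poset_class_cases)
  have "p = subposet_class r A" using A by (simp add: Restr_ground)
  then show ?thesis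
    using chain_coeff_nonzero[OF A(1,2) subset_refl] assms subposet_size[OF A(1,2) subset_refl]
    by metis
qed

text \<open>Splitting off the first block \<open>T\<close> of a chain in \<open>S\<close> commutes with splitting \<open>B\<close> at \<open>S\<close>: both
  sides range over pairs of ideals \<open>T \<subseteq> S\<close> of \<open>B\<close>.\<close>

lemma chain_coeff_append:
  assumes "finite A" "partial_order_on A r" "B \<subseteq> A"
  shows "(chain_coeff (as @ bs) (subposet_class r B) :: 'k::field poly fract) =
    (\<Sum>S | poset_ideal B r S.
      chain_coeff as (subposet_class r S) * chain_coeff bs (subposet_class r (B - S)))"
  using assms(3)
proof (induction as arbitrary: B)
  case Nil
  have fin: "finite {S. poset_ideal B r S}"
    using assms Nil by (intro finite_poset_ideals) (auto intro: finite_subset)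
  \<comment> \<open>The empty list only sees the zero class, so only the empty ideal
    contributes.\<close>
  have "(\<Sum>S | poset_ideal B r S. chain_coeff [] (subposet_class r S) *
          chain_coeff bs (subposet_class r (B - S))) =
    (\<Sum>S | poset_ideal B r S. if S = {} then chain_coeff bs (subposet_class r B) else (0 :: 'k poly fract))"
  proof (rule sum.cong[OF refl])
    fix S assume "S \<in> {S. poset_ideal B r S}"
    then have "S \<subseteq> A" using Nil by (auto simp: poset_ideal_def)
    then show "chain_coeff [] (subposet_class r S) * chain_coeff bs (subposet_class r (B - S)) =
       (if S = {} then chain_coeff bs (subposet_class r B) else (0 :: 'k poly fract))"
      using subposet_eq_0_iff[OF assms(1,2)] by auto
  qed
  also have "\<dots> = chain_coeff ([] @ bs) (subposet_class r B)"
    using fin by (simp add: poset_ideal_def)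
  finally show ?case by simp
next
  case (Cons a as)
  have finB: "finite B" using assms Cons.prems by (auto intro: finite_subset)
  let ?q = "\<lambda>T. qvar ^ rk (subposet_class r T) :: 'k poly fract"
  let ?c = "\<lambda>as T. chain_coeff as (subposet_class r T) :: 'k poly fract"
  have "?c ((a # as) @ bs) B = (\<Sum>T | poset_ideal B r T \<and> card T = a. ?q T * ?c (as @ bs) (B - T))"
    using chain_coeff_Cons_subposet[OF assms(1,2) Cons.prems] by simp
  also have "\<dots> = (\<Sum>T | poset_ideal B r T \<and> card T = a.
      \<Sum>U | poset_ideal (B - T) r U. ?q T * (?c as U * ?c bs (B - T - U)))"
  proof (rule sum.cong[OF refl])
    fix T
    have "B - T \<subseteq> A" using Cons.prems by auto
    show "?q T * ?c (as @ bs) (B - T) =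
       (\<Sum>U | poset_ideal (B - T) r U. ?q T * (?c as U * ?c bs (B - T - U)))"
      unfolding Cons.IH[OF \<open>B - T \<subseteq> A\<close>] by (rule sum_distrib_left)
  qed
  also have "\<dots> = (\<Sum>(T, U)\<in>(SIGMA T : {T. poset_ideal B r T \<and> card T = a}.
      {U. poset_ideal (B - T) r U}). ?q T * (?c as U * ?c bs (B - T - U)))"
    using finite_poset_ideals finB by (intro sum.Sigma) (auto intro: finite_subset[OF _ finite_poset_ideals[OF finB, of r]])
  also have "\<dots> = (\<Sum>(S, T)\<in>(SIGMA S : {S. poset_ideal B r S}.
      {T. poset_ideal S r T \<and> card T = a}). ?q T * ?c as (S - T) * ?c bs (B - S))"
  \<comment> \<open>\<open>T\<close> is the first block and \<open>U\<close> the rest of the ideal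
    \<open>S\<close>, so \<open>S\<close> is the disjoint union of \<open>T\<close> and
    \<open>U\<close>.\<close>
  proof (rule sum.reindex_bij_witness[where i = "\<lambda>(S, T). (T, S - T)" and j = "\<lambda>(T, U). (T \<union> U, T)"])
    fix x assume "x \<in> (SIGMA T : {T. poset_ideal B r T \<and> card T = a}. {U. poset_ideal (B - T) r U})"
    then obtain T U where x: "x = (T, U)" "poset_ideal B r T" "card T = a" "poset_ideal (B - T) r U"
      by auto
    have "T \<union> U - T = U" "B - T - U = B - (T \<union> U)" using x by (auto simp: poset_ideal_def)
    then show "(case x of (T, U) \<Rightarrow> (T \<union> U, T)) \<in>
        (SIGMA S : {S. poset_ideal B r S}. {T. poset_ideal S r T \<and> card T = a})"
      "(case (case x of (T, U) \<Rightarrow> (T \<union> U, T)) of (S, T) \<Rightarrow> (T, S - T)) = x"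
      "(case (case x of (T, U) \<Rightarrow> (T \<union> U, T)) of (S, T) \<Rightarrow> ?q T * ?c as (S - T) * ?c bs (B - S)) =
       (case x of (T, U) \<Rightarrow> ?q T * (?c as U * ?c bs (B - T - U)))"
      using x by (auto simp: poset_ideal_def mult.assoc)
  next
    fix x assume "x \<in> (SIGMA S : {S. poset_ideal B r S}. {T. poset_ideal S r T \<and> card T = a})"
    then obtain S T where x: "x = (S, T)" "poset_ideal B r S" "poset_ideal S r T" "card T = a"
      by auto
    then show "(case (case x of (S, T) \<Rightarrow> (T, S - T)) of (T, U) \<Rightarrow> (T \<union> U, T)) = x"
      "(case x of (S, T) \<Rightarrow> (T, S - T)) \<in>
        (SIGMA T : {T. poset_ideal B r T \<and> card T = a}. {U. poset_ideal (B - T) r U})"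
      by (auto 0 3 simp: poset_ideal_def)
  qed
  also have "\<dots> = (\<Sum>S | poset_ideal B r S. \<Sum>T | poset_ideal S r T \<and> card T = a.
      ?q T * ?c as (S - T) * ?c bs (B - S))"
  proof (rule sum.Sigma[symmetric])
    show "finite {S. poset_ideal B r S}" by (rule finite_poset_ideals[OF finB])
    show "\<forall>S\<in>{S. poset_ideal B r S}. finite {T. poset_ideal S r T \<and> card T = a}"
    proof
      fix S assume "S \<in> {S. poset_ideal B r S}"
      then have "finite S" using finB by (auto simp: poset_ideal_def intro: finite_subset)
      then show "finite {T. poset_ideal S r T \<and> card T = a}"
        using finite_subset[OF _ finite_poset_ideals[of S r]] by (simp add: Collect_mono)
    qed
  qed
  also have "\<dots> = (\<Sum>S | poset_ideal B r S. ?c (a # as) S * ?c bs (B - S))"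
  proof (rule sum.cong[OF refl])
    fix S assume "S \<in> {S. poset_ideal B r S}"
    then have "S \<subseteq> A" using Cons.prems by (auto simp: poset_ideal_def)
    then show "(\<Sum>T | poset_ideal S r T \<and> card T = a. ?q T * ?c as (S - T) * ?c bs (B - S)) =
        ?c (a # as) S * ?c bs (B - S)"
      by (simp only: chain_coeff_Cons_subposet[OF assms(1,2)] sum_distrib_right)
  qed
  finally show ?case .
qed

text \<open>Compatibility with coproducts, coefficient by coefficient: concatenation of index lists
  corresponds to cutting a poset at an ideal.\<close>

lemma chain_coeff_comult:
  "chain_coeff (as @ bs) p =
    lin_form (\<lambda>(s, t). chain_coeff as s * chain_coeff bs t) (class_comult p)"
proof -
  obtain A r where A: "finite A" "partial_order_on A r" "p = class_of A r"
    by (rule poset_class_cases)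
  have p: "p = subposet_class r A" using A by (simp add: Restr_ground)
  show ?thesis
    unfolding p chain_coeff_append[OF A(1,2) subset_refl] class_comult_subposet[OF A(1,2) subset_refl]
    by (simp add: lin_form_sum)
qed

section \<open>The candidate for the morphism on basis elements\<close>

text \<open>\<open>Abs_poly_mapping\<close> is meaningful here because only the finitely many
  compositions of \<open>class_size p\<close> have a nonzero coefficient.\<close>

definition class_image :: "poset_class \<Rightarrow> 'k::field poly fract qsym" where
  "class_image p = Abs_poly_mapping (\<lambda>\<alpha>. chain_coeff (parts \<alpha>) p)"

lemma lookup_class_image: "Poly_Mapping.lookup (class_image p) \<alpha> = chain_coeff (parts \<alpha>) p"
proof -
  have "finite {\<alpha>. (chain_coeff (parts \<alpha>) p :: 'a poly fract) \<noteq> 0}"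
    by (rule finite_subset[OF _ finite_compositions_of[of "class_size p"]])
      (auto dest: chain_coeff_size)
  then show ?thesis by (simp add: class_image_def)
qed

lemma qsym_comult_class_image:
  "qsym_comult (class_image p) = tensor_map (lin_ext class_image) (class_comult p)"
proof (rule poly_mapping_eqI)
  fix x :: "composition \<times> composition"
  obtain \<beta> \<gamma> where x: "x = (\<beta>, \<gamma>)" by force
  have "parts (composition (parts \<beta> @ parts \<gamma>)) = parts \<beta> @ parts \<gamma>"
    using parts_pos by (intro parts_composition) auto
  then show "Poly_Mapping.lookup (qsym_comult (class_image p)) x =
      Poly_Mapping.lookup (tensor_map (lin_ext class_image) (class_comult p)) x"
    by (simp add: x lookup_qsym_comult lookup_tensor_map lookup_class_image chain_coeff_comult)
qed

lemma lookup_qsym_unit: "Poly_Mapping.lookup qsym_unit \<alpha> = (if parts \<alpha> = [] then 1 else 0)"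
  using parts_composition[of "[]"] by (auto simp: qsym_unit_def lookup_basis dest: arg_cong[of _ _ composition] simp: parts_inverse)

lemma class_size_eq_0_iff: "class_size p = 0 \<longleftrightarrow> p = 0"
proof -
  obtain A r where A: "finite A" "partial_order_on A r" "p = class_of A r"
    by (rule poset_class_cases)
  then show ?thesis by (simp add: class_size_class_of class_of_eq_0_iff)
qed

lemma class_image_0: "class_image 0 = qsym_unit"
proof (rule poly_mapping_eqI)
  fix \<alpha>
  have "parts \<alpha> = []" if "chain_coeff (parts \<alpha>) 0 \<noteq> (0 :: 'a poly fract)"
    using chain_coeff_size[OF that] class_size_eq_0_iff[of 0] parts_pos[of _ \<alpha>] by (cases "parts \<alpha>") auto
  then show "Poly_Mapping.lookup (class_image 0) \<alpha> = (Poly_Mapping.lookup qsym_unit \<alpha> :: 'a poly fract)"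
    by (auto simp: lookup_class_image lookup_qsym_unit)
qed

lemma lin_form_lin_ext: "lin_form g (lin_ext f x) = lin_form (\<lambda>a. lin_form g (f a)) x"
  unfolding lin_ext_def lin_form_sum lin_form_scale by (simp add: lin_form_def)

lemma qsym_counit_eq: "qsym_counit f = Poly_Mapping.lookup f (composition [])"
proof -
  have "(\<lambda>\<alpha>. if parts \<alpha> = [] then 1 else 0) = (\<lambda>\<alpha>. if \<alpha> = composition [] then 1 else (0 :: 'a))"
    using parts_composition[of "[]"] by (auto simp: fun_eq_iff dest: arg_cong[of _ _ composition] simp: parts_inverse)
  then show ?thesis by (simp add: qsym_counit_def lin_form_delta)
qed

text \<open>Each degree \<open>n\<close> has exactly one composition with at most one part: the
  empty one for \<open>n = 0\<close> and \<open>[n]\<close> otherwise.\<close>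

lemma zeta_Q_homogeneous:
  assumes "f \<in> qsym_homogeneous n"
  shows "zeta_Q f = Poly_Mapping.lookup f (composition (if n = 0 then [] else [n]))"
proof -
  let ?b = "composition (if n = 0 then [] else [n])"
  have b: "parts ?b = (if n = 0 then [] else [n])" by (rule parts_composition) auto
  have "zeta_Q f = lin_form (\<lambda>\<alpha>. if \<alpha> = ?b then 1 else 0) f"
    unfolding zeta_Q_def lin_form_def
  proof (rule sum.cong[OF refl])
    fix \<alpha> assume "\<alpha> \<in> Poly_Mapping.keys f"
    then have "sum_list (parts \<alpha>) = n" using assms by (auto simp: qsym_homogeneous_def)
    then have "length (parts \<alpha>) \<le> 1 \<longleftrightarrow> parts \<alpha> = parts ?b"
      unfolding b using parts_pos[of _ \<alpha>] by (cases "parts \<alpha>" rule: remdups_adj.cases) auto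
    then show "Poly_Mapping.lookup f \<alpha> * (if length (parts \<alpha>) \<le> 1 then 1 else 0) =
        Poly_Mapping.lookup f \<alpha> * (if \<alpha> = ?b then 1 else 0)"
      by (simp add: parts_inject)
  qed
  then show ?thesis by (simp add: lin_form_delta)
qed

lemma class_image_homogeneous: "class_image p \<in> qsym_homogeneous (class_size p)"
  by (auto simp: qsym_homogeneous_def in_keys_iff lookup_class_image chain_coeff_size)

lemma rk_0: "rk 0 = 0"
  using rk.abs_eq[OF poset_iso_refl[of "{}" "{}"]] by (simp add: zero_poset_class.abs_eq)

text \<open>The whole poset is its only ideal of full size, so a single term remains.\<close>

lemma chain_coeff_singleton:
  assumes "class_size p > 0"
  shows "chain_coeff [class_size p] p = qvar ^ rk p"
proof -
  obtain A r where A: "finite A" "partial_order_on A r" "p = class_of A r"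
    by (rule poset_class_cases)
  have p: "p = subposet_class r A" using A by (simp add: Restr_ground)
  have eq: "S = A" if "poset_ideal A r S" "card S = card A" for S
    using card_subset_eq[OF A(1) poset_ideal_subset[OF that(1)] that(2)] .
  have size: "class_size p = card A" unfolding p by (rule subposet_size[OF A(1,2) subset_refl])
  have "{S. poset_ideal A r S \<and> card S = card A} = {A}"
    using eq by (auto simp: poset_ideal_def)
  then have "chain_coeff [card A] (subposet_class r A) =
      qvar ^ rk (subposet_class r A) * chain_coeff [] (subposet_class r (A - A))"
    unfolding chain_coeff_Cons_subposet[OF A(1,2) subset_refl] by simp
  then show ?thesis
    using class_of_eq_0_iff[of "{}" "{}"] unfolding size by (simp add: p)
qed

lemma zeta_Q_class_image: "zeta_Q (class_image p) = qvar ^ rk p"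
proof (cases "class_size p = 0")
  case True
  then show ?thesis
    using zeta_Q_homogeneous[OF class_image_homogeneous[of p]] class_size_eq_0_iff[of p]
    by (simp add: class_image_0 lookup_qsym_unit parts_composition rk_0)
next
  case False
  then have "zeta_Q (class_image p) = chain_coeff [class_size p] p"
    using zeta_Q_homogeneous[OF class_image_homogeneous[of p]]
    by (simp add: lookup_class_image parts_composition del: chain_coeff.simps)
  also have "\<dots> = qvar ^ rk p" using False by (simp add: chain_coeff_singleton del: chain_coeff.simps)
  finally show ?thesis .
qed

section \<open>Uniqueness of the morphism\<close>

text \<open>Induction on the list: the counit fixes the coefficient of the empty list, and the
  coproduct splits off the first part, whose coefficient is fixed by degree and character.\<close>

lemma hopf_morphism_coeff:
  assumes F: "graded_hopf_morphism F" "\<And>x. zeta_Q (F x) = zeta_q x"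
  shows "Poly_Mapping.lookup (F (basis p)) \<alpha> = chain_coeff (parts \<alpha>) p"
proof -
  have hom: "F (basis p) \<in> qsym_homogeneous (class_size p)" for p
  proof -
    have "basis p \<in> (poset_homogeneous (class_size p) :: 'a poly fract poset_alg set)"
      by (simp add: poset_homogeneous_def basis_def)
    then show ?thesis using F(1) by (auto simp: graded_hopf_morphism_def)
  qed
  \<comment> \<open>In degree \<open>a\<close> this coefficient is the value of the character; in
    all other degrees it vanishes by homogeneity.\<close>
  have zeta: "Poly_Mapping.lookup (F (basis p)) (composition [a]) =
      (if class_size p = a then qvar ^ rk p else 0)" if "a > 0" for a p
  proof (cases "class_size p = a")
    case True
    then show ?thesis
      using zeta_Q_homogeneous[OF hom[of p]] F(2)[of "basis p"] that by (simp add: zeta_q_def)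
  next
    case False
    have "sum_list (parts (composition [a])) = a" using that by (simp add: parts_composition)
    then show ?thesis
      using hom[of p] False by (force simp: qsym_homogeneous_def in_keys_iff)
  qed
  have "Poly_Mapping.lookup (F (basis p)) (composition as) = chain_coeff as p"
    if "\<forall>a\<in>set as. a > 0" for as
    using that
  proof (induction as arbitrary: p)
    case Nil
    have "qsym_counit (F (basis p)) = poset_counit (basis p)"
      using F(1) by (auto simp: graded_hopf_morphism_def)
    then show ?case by (simp add: qsym_counit_eq poset_counit_def)
  next
    case (Cons a as)
    have comult: "qsym_comult (F (basis p)) = tensor_map F (class_comult p)"
      using F(1) by (auto simp: graded_hopf_morphism_def poset_comult_def)
    have "parts (composition [a]) @ parts (composition as) = a # as"
      using Cons.prems by (simp add: parts_composition)
    then have "Poly_Mapping.lookup (F (basis p)) (composition (a # as)) =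
        Poly_Mapping.lookup (qsym_comult (F (basis p))) (composition [a], composition as)"
      by (simp add: lookup_qsym_comult)
    also have "\<dots> = chain_coeff (a # as) p"
      unfolding comult lookup_tensor_map chain_coeff.simps
      by (rule arg_cong[where f = "\<lambda>g. lin_form g (class_comult p)"])
        (use Cons in \<open>auto simp: fun_eq_iff zeta\<close>)
    finally show ?case .
  qed
  from this[of "parts \<alpha>"] show ?thesis using parts_pos by (auto simp: parts_inverse)
qed

text \<open>The description operator is resolved by showing that the candidate is a morphism and the
  only one. Multiplicativity stays a premise here, since it becomes visible only after coefficients
  are rewritten as sums over order-preserving maps.\<close>

lemma Psi_q_eqI:
  assumes mult: "\<And>x y. qsym_series (lin_ext class_image (x * y) :: 'k poly fract qsym) =
    series_mult (qsym_series (lin_ext class_image x)) (qsym_series (lin_ext class_image y))"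
  shows "Psi_q = (lin_ext class_image :: 'k::field poly fract poset_alg \<Rightarrow> _)"
  unfolding Psi_q_def
proof (rule the_equality)
  let ?F = "lin_ext class_image :: 'k poly fract poset_alg \<Rightarrow> 'k poly fract qsym"
  have "?F x \<in> qsym_homogeneous n" if "x \<in> poset_homogeneous n" for x n
    unfolding qsym_homogeneous_def
  proof clarify
    fix \<alpha> assume "\<alpha> \<in> Poly_Mapping.keys (?F x)"
    then have "(\<Sum>p\<in>Poly_Mapping.keys x.
        Poly_Mapping.lookup x p * Poly_Mapping.lookup (class_image p) \<alpha>) \<noteq> 0"
      by (simp add: in_keys_iff lookup_lin_ext lin_form_def)
    then obtain p where "p \<in> Poly_Mapping.keys x" "Poly_Mapping.lookup (class_image p) \<alpha> \<noteq> (0 :: 'k poly fract)"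
      by (metis (no_types, lifting) mult_not_zero sum.not_neutral_contains_not_neutral)
    then show "sum_list (parts \<alpha>) = n"
      using that chain_coeff_size[of "parts \<alpha>" p] by (auto simp: lookup_class_image poset_homogeneous_def)
  qed
  moreover have "?F 1 = qsym_unit"
    using lin_ext_basis[of class_image 0] by (simp add: basis_def class_image_0)
  moreover have "qsym_comult (?F x) = tensor_map ?F (poset_comult x)" for x
  proof (rule poly_mapping_eqI)
    fix b :: "composition \<times> composition"
    obtain \<beta> \<gamma> where b: "b = (\<beta>, \<gamma>)" by force
    have "Poly_Mapping.lookup (qsym_comult (?F x)) b =
        lin_form (\<lambda>p. Poly_Mapping.lookup (qsym_comult (class_image p)) b) x"
      by (simp add: b lookup_qsym_comult lookup_lin_ext)
    also have "\<dots> = Poly_Mapping.lookup (tensor_map ?F (poset_comult x)) b"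
      unfolding qsym_comult_class_image b lookup_tensor_map poset_comult_def lin_form_lin_ext ..
    finally show "Poly_Mapping.lookup (qsym_comult (?F x)) b =
        Poly_Mapping.lookup (tensor_map ?F (poset_comult x)) b" .
  qed
  moreover have "qsym_counit (?F x) = poset_counit x" for x
    by (simp add: qsym_counit_eq lookup_lin_ext poset_counit_def lookup_class_image parts_composition)
  moreover have "zeta_Q (?F x) = zeta_q x" for x
    unfolding zeta_q_def zeta_Q_class_image[symmetric] by (simp add: zeta_Q_def lin_form_lin_ext)
  ultimately show "graded_hopf_morphism ?F \<and> (\<forall>x. zeta_Q (?F x) = zeta_q x)"
    using linear_lin_ext mult by (auto simp: graded_hopf_morphism_def)
next
  fix F :: "'k poly fract poset_alg \<Rightarrow> 'k poly fract qsym"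
  assume F: "graded_hopf_morphism F \<and> (\<forall>x. zeta_Q (F x) = zeta_q x)"
  have "F (basis p) = class_image p" for p
    by (rule poly_mapping_eqI) (use F hopf_morphism_coeff in \<open>auto simp: lookup_class_image\<close>)
  then show "F = lin_ext class_image"
    using linear_eq_lin_ext[of F] F by (simp add: graded_hopf_morphism_def)
qed

section \<open>Order-preserving maps\<close>

text \<open>Distinct indices do not interfere, so exponents can be compared position by
  position.\<close>

lemma sum_single_eq_iff:
  assumes "distinct js" "length as = length js"
  shows "(\<Sum>k<length js. Poly_Mapping.single (js ! k) (as ! k)) = m \<longleftrightarrow>
    (\<forall>k<length js. Poly_Mapping.lookup m (js ! k) = as ! k) \<and>
    (\<forall>v. v \<notin> set js \<longrightarrow> Poly_Mapping.lookup m v = 0)" (is "?s = m \<longleftrightarrow> ?rhs")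
proof -
  have at: "Poly_Mapping.lookup ?s (js ! i) = as ! i" if "i < length js" for i
  proof -
    have "Poly_Mapping.lookup ?s (js ! i) = (\<Sum>k<length js. if k = i then as ! k else 0)"
      unfolding lookup_sum lookup_single when_def
      using assms(1) that by (intro sum.cong) (auto simp: nth_eq_iff_index_eq)
    then show ?thesis using that by simp
  qed
  have off: "Poly_Mapping.lookup ?s v = 0" if "v \<notin> set js" for v
    unfolding lookup_sum lookup_single when_def
    using that by (intro sum.neutral) (auto simp: set_conv_nth)
  show ?thesis
  proof
    assume "?s = m" then show ?rhs using at off by blast
  next
    assume r: ?rhs
    show "?s = m"
    proof (rule poly_mapping_eqI)
      fix v
      show "Poly_Mapping.lookup ?s v = Poly_Mapping.lookup m v"
        using r at off by (cases "v \<in> set js") (auto simp: in_set_conv_nth)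
    qed
  qed
qed

text \<open>The only composition \<open>\<alpha>\<close> for which \<open>M\<^sub>\<alpha>\<close> contains the monomial \<open>m\<close>.\<close>

definition exponent_list :: "(nat \<Rightarrow>\<^sub>0 nat) \<Rightarrow> nat list" where
  "exponent_list m = map (Poly_Mapping.lookup m) (sorted_list_of_set (Poly_Mapping.keys m))"

lemma exponent_list_pos: "\<forall>a\<in>set (exponent_list m). a > 0"
  by (auto simp: exponent_list_def in_keys_iff)

text \<open>Since the parts are positive, an index sequence producing \<open>m\<close> has exactly
  \<open>keys m\<close> as its set. Being increasing, it is the sorted list of keys, so at most one
  sequence is counted. Its entries are positive, which excludes the index 0.\<close>

lemma M_series_eq:
  "M_series \<alpha> m =
    (if 0 \<notin> Poly_Mapping.keys m \<and> parts \<alpha> = exponent_list m then 1 else 0)"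
proof -
  let ?L = "sorted_list_of_set (Poly_Mapping.keys m)"
  let ?J = "{js. length js = length (parts \<alpha>) \<and> sorted_wrt (<) js \<and> (\<forall>j\<in>set js. j > 0) \<and>
     (\<Sum>k<length js. Poly_Mapping.single (js ! k) (parts \<alpha> ! k)) = m}"
  have "js \<in> ?J \<longleftrightarrow> js = ?L \<and> 0 \<notin> Poly_Mapping.keys m \<and> parts \<alpha> = exponent_list m" for js
  proof
    assume js: "js \<in> ?J"
    then have d: "distinct js" by (auto simp: strict_sorted_iff)
    have m: "\<forall>k<length js. Poly_Mapping.lookup m (js ! k) = parts \<alpha> ! k"
      "\<forall>v. v \<notin> set js \<longrightarrow> Poly_Mapping.lookup m v = 0"
      using js iffD1[OF sum_single_eq_iff[OF d, of "parts \<alpha>" m]] unfolding mem_Collect_eq by metis+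
    have "Poly_Mapping.lookup m v \<noteq> 0" if v: "v \<in> set js" for v
    proof -
      obtain k where k: "k < length js" "v = js ! k" using v by (metis in_set_conv_nth)
      then have "parts \<alpha> ! k \<in> set (parts \<alpha>)" using js by auto
      then have "parts \<alpha> ! k > 0" by (rule parts_pos)
      then show ?thesis using m(1) k by simp
    qed
    then have keys: "Poly_Mapping.keys m = set js"
      using m(2) by (auto simp: in_keys_iff)
    have "js = ?L" unfolding keys using js
      by (simp add: strict_sorted_iff sorted_list_of_set.idem_if_sorted_distinct)
    moreover have "parts \<alpha> = map (Poly_Mapping.lookup m) js"
      using js m(1) by (intro nth_equalityI) auto
    moreover have "0 \<notin> Poly_Mapping.keys m" unfolding keys using js by auto
    ultimately show "js = ?L \<and> 0 \<notin> Poly_Mapping.keys m \<and> parts \<alpha> = exponent_list m"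
      by (simp add: exponent_list_def)
  next
    assume js: "js = ?L \<and> 0 \<notin> Poly_Mapping.keys m \<and> parts \<alpha> = exponent_list m"
    have "0 < j" if "j \<in> Poly_Mapping.keys m" for j using js that by (cases j) auto
    moreover have "(\<Sum>k<length js. Poly_Mapping.single (js ! k) (parts \<alpha> ! k)) = m"
      by (subst sum_single_eq_iff) (use js in \<open>auto simp: exponent_list_def in_keys_iff\<close>)
    ultimately show "js \<in> ?J" using js by (auto simp: exponent_list_def)
  qed
  then have "?J = (if 0 \<notin> Poly_Mapping.keys m \<and> parts \<alpha> = exponent_list m then {?L} else {})"
    by auto
  then show ?thesis by (simp add: M_series_def)
qed

text \<open>At most one basis element contributes to each monomial, so evaluating the series means
  reading one coordinate.\<close>

lemma qsym_series_eq:
  "qsym_series f m = (if 0 \<in> Poly_Mapping.keys m then 0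
    else Poly_Mapping.lookup f (composition (exponent_list m)))"
proof -
  have "parts \<alpha> = exponent_list m \<longleftrightarrow> \<alpha> = composition (exponent_list m)" for \<alpha>
    using composition_inverse[of "exponent_list m"] exponent_list_pos parts_inverse[of \<alpha>] by auto
  then show ?thesis
    by (auto simp: qsym_series_def M_series_eq in_keys_iff if_distrib cong: if_cong)
qed

section \<open>Order-preserving maps with a given monomial\<close>

definition map_monomial :: "nat set \<Rightarrow> (nat \<Rightarrow> nat) \<Rightarrow> (nat \<Rightarrow>\<^sub>0 nat)" where
  "map_monomial A f = (\<Sum>x\<in>A. Poly_Mapping.single (f x) 1)"

lemma lookup_map_monomial:
  "finite A \<Longrightarrow> Poly_Mapping.lookup (map_monomial A f) v = card {x\<in>A. f x = v}"
  by (simp add: map_monomial_def lookup_sum lookup_single when_def sum.inter_filter[symmetric])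

lemma keys_map_monomial: "finite A \<Longrightarrow> Poly_Mapping.keys (map_monomial A f) = f ` A"
  by (auto simp: in_keys_iff lookup_map_monomial card_gt_0_iff)

lemma map_monomial_cong: "(\<And>x. x \<in> A \<Longrightarrow> f x = g x) \<Longrightarrow> map_monomial A f = map_monomial A g"
  by (simp add: map_monomial_def)

text \<open>Extensionality makes each map on \<open>A\<close> count once and keeps the set finite
  for finite \<open>A\<close>.\<close>

definition op_maps :: "nat set \<Rightarrow> nat rel \<Rightarrow> (nat \<Rightarrow>\<^sub>0 nat) \<Rightarrow> (nat \<Rightarrow> nat) set" where
  "op_maps A r m = {f \<in> extensional A. map_monomial A f = m \<and> (\<forall>x\<in>A. \<forall>y\<in>A. (x, y) \<in> r \<longrightarrow> f x \<le> f y)}"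

lemma op_maps_subset_PiE: "finite A \<Longrightarrow> op_maps A r m \<subseteq> A \<rightarrow>\<^sub>E Poly_Mapping.keys m"
  by (auto simp: op_maps_def keys_map_monomial PiE_iff extensional_def)

lemma finite_op_maps: "finite A \<Longrightarrow> finite (op_maps A r m)"
  by (rule finite_subset[OF op_maps_subset_PiE]) (auto intro: finite_PiE)

text \<open>Translates the condition on the monomial into fibre sizes, the form in which a chain of
  ideals records a map.\<close>

lemma map_monomial_eq_iff:
  assumes "finite A"
  shows "map_monomial A f = m \<longleftrightarrow> f ` A \<subseteq> Poly_Mapping.keys m \<and>
    (\<forall>j\<in>Poly_Mapping.keys m. card {x\<in>A. f x = j} = Poly_Mapping.lookup m j)"
proof
  assume "map_monomial A f = m"
  then show "f ` A \<subseteq> Poly_Mapping.keys m \<and>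
    (\<forall>j\<in>Poly_Mapping.keys m. card {x\<in>A. f x = j} = Poly_Mapping.lookup m j)"
    using lookup_map_monomial[OF assms, of f] keys_map_monomial[OF assms, of f] by auto
next
  assume r: "f ` A \<subseteq> Poly_Mapping.keys m \<and>
    (\<forall>j\<in>Poly_Mapping.keys m. card {x\<in>A. f x = j} = Poly_Mapping.lookup m j)"
  show "map_monomial A f = m"
  proof (rule poly_mapping_eqI)
    fix v
    have "card {x\<in>A. f x = v} = 0" if "v \<notin> Poly_Mapping.keys m"
    proof -
      have "{x\<in>A. f x = v} = {}" using r that by auto
      then show ?thesis by (simp only: card.empty)
    qed
    then show "Poly_Mapping.lookup (map_monomial A f) v = Poly_Mapping.lookup m v"
      unfolding lookup_map_monomial[OF assms] using r
      by (cases "v \<in> Poly_Mapping.keys m") (simp_all add: in_keys_iff)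
  qed
qed

text \<open>Exponents are natural numbers, so both terms live on \<open>keys m\<close> and are
  bounded by the largest exponent of \<open>m\<close>. Restriction to \<open>keys m\<close>
  therefore embeds the pairs into a finite set of functions.\<close>

lemma finite_poly_mapping_decompositions:
  "finite {(a, b). a + b = (m :: nat \<Rightarrow>\<^sub>0 nat)}"
proof (rule finite_imageD)
  let ?e = "\<lambda>c :: nat \<Rightarrow>\<^sub>0 nat. restrict (Poly_Mapping.lookup c) (Poly_Mapping.keys m)"
  let ?K = "Poly_Mapping.keys m"
  let ?N = "Max (Poly_Mapping.lookup m ` ?K)"
  have "?e a \<in> ?K \<rightarrow>\<^sub>E {..?N} \<and> ?e b \<in> ?K \<rightarrow>\<^sub>E {..?N}" if "a + b = m" for a b
  proof -
    have "Poly_Mapping.lookup a v \<le> ?N \<and> Poly_Mapping.lookup b v \<le> ?N" if "v \<in> ?K" for v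
    proof -
      have "Poly_Mapping.lookup a v + Poly_Mapping.lookup b v = Poly_Mapping.lookup m v"
        using \<open>a + b = m\<close> by (auto simp: lookup_add)
      moreover have "Poly_Mapping.lookup m v \<le> ?N" using that by (intro Max_ge) auto
      ultimately show ?thesis by linarith
    qed
    then show ?thesis by (simp add: PiE_iff del: restrict_PiE_iff)
  qed
  then have "(\<lambda>(a, b). (?e a, ?e b)) ` {(a, b). a + b = m} \<subseteq> (?K \<rightarrow>\<^sub>E {..?N}) \<times> (?K \<rightarrow>\<^sub>E {..?N})"
    unfolding image_subset_iff by (auto simp del: restrict_PiE_iff)
  then show "finite ((\<lambda>(a, b). (?e a, ?e b)) ` {(a, b). a + b = m})"
    by (rule finite_subset) (simp add: finite_PiE)
  have inj: "a = c" if "?e a = ?e c" "a + b = m" "c + d = m" for a b c d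
  proof (rule poly_mapping_eqI)
    fix v
    show "Poly_Mapping.lookup a v = Poly_Mapping.lookup c v"
    proof (cases "v \<in> ?K")
      case True
      then show ?thesis using fun_cong[OF that(1), of v] by simp
    next
      case False
      then have "Poly_Mapping.lookup (a + b) v = 0" "Poly_Mapping.lookup (c + d) v = 0"
        using that by (auto simp: in_keys_iff)
      then show ?thesis by (simp add: lookup_add)
    qed
  qed
  show "inj_on (\<lambda>(a, b). (?e a, ?e b)) {(a, b). a + b = m}"
  proof (rule inj_onI)
    fix x y
    assume xy: "x \<in> {(a, b). a + b = m}" "y \<in> {(a, b). a + b = m}"
      "(case x of (a, b) \<Rightarrow> (?e a, ?e b)) = (case y of (a, b) \<Rightarrow> (?e a, ?e b))"
    obtain a b c d where "x = (a, b)" "y = (c, d)" by force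
    with xy have e: "?e a = ?e c" "?e b = ?e d" and s: "a + b = m" "c + d = m" by auto
    from s have "b + a = m" "d + c = m" by (simp_all only: add.commute)
    with e s have "a = c" "b = d" using inj by blast+
    then show "x = y" using \<open>x = (a, b)\<close> \<open>y = (c, d)\<close> by simp
  qed
qed

section \<open>Additivity of the rank under disjoint unions\<close>

lemma rk_class_of:
  assumes "finite A" "partial_order_on A r"
  shows "rk (class_of A r) = card A - card (components A r)"
  using rk.abs_eq[OF poset_iso_refl[OF assms]] by (simp add: class_of_def)

text \<open>Guards the natural-number subtraction in \<open>rk\<close> against truncation.\<close>

lemma card_components_le: "finite A \<Longrightarrow> card (components A r) \<le> card A"
proof -
  assume "finite A"
  have "components A r = (\<lambda>x. (hasse A r \<union> (hasse A r)\<inverse>)\<^sup>* `` {x}) ` A"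
    by (auto simp: components_def quotient_def)
  then show ?thesis using \<open>finite A\<close> card_image_le by metis
qed

text \<open>A path starting in \<open>A\<close> never leaves \<open>A\<close>, because every edge of
  \<open>T\<close> has both ends in \<open>B\<close>.\<close>

lemma rtrancl_Un_Image:
  assumes "R \<subseteq> A \<times> A" "T \<subseteq> B \<times> B" "A \<inter> B = {}" "x \<in> A"
  shows "(R \<union> T)\<^sup>* `` {x} = R\<^sup>* `` {x}"
proof -
  have "(x, y) \<in> R\<^sup>* \<and> y \<in> A" if "(x, y) \<in> (R \<union> T)\<^sup>*" for y
    using that
  proof (induction rule: rtrancl_induct)
    case (step y z)
    then have "(y, z) \<in> R" using assms(2,3) by auto
    then show ?case using step.IH assms(1) by (auto intro: rtrancl_into_rtrancl)
  qed (use assms in auto)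
  then show ?thesis using rtrancl_mono[of R "R \<union> T"] by blast
qed

text \<open>The Hasse diagram of a disjoint union is the union of the two diagrams, so every
  component lies on one side. Components are nonempty, hence those of the two sides differ.\<close>

lemma card_components_Un:
  assumes "finite A" "finite B" "r \<subseteq> A \<times> A" "s \<subseteq> B \<times> B" "A \<inter> B = {}"
  shows "card (components (A \<union> B) (r \<union> s)) = card (components A r) + card (components B s)"
proof -
  let ?R = "hasse A r \<union> (hasse A r)\<inverse>" and ?S = "hasse B s \<union> (hasse B s)\<inverse>"
  have sub: "?R \<subseteq> A \<times> A" "?S \<subseteq> B \<times> B" using assms(3,4) by (auto simp: hasse_def)
  have "hasse (A \<union> B) (r \<union> s) = hasse A r \<union> hasse B s"
    unfolding hasse_def using assms(3,4,5) by blast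
  then have "hasse (A \<union> B) (r \<union> s) \<union> (hasse (A \<union> B) (r \<union> s))\<inverse> = ?R \<union> ?S" by auto
  then have "components (A \<union> B) (r \<union> s) = (\<lambda>x. (?R \<union> ?S)\<^sup>* `` {x}) ` A \<union> (\<lambda>x. (?R \<union> ?S)\<^sup>* `` {x}) ` B"
    by (auto simp: components_def quotient_def)
  also have "(\<lambda>x. (?R \<union> ?S)\<^sup>* `` {x}) ` A = components A r"
    using rtrancl_Un_Image[OF sub assms(5)] by (auto simp: components_def quotient_def)
  also have "(\<lambda>x. (?R \<union> ?S)\<^sup>* `` {x}) ` B = components B s"
    using rtrancl_Un_Image[OF sub(2,1)] assms(5)
    by (auto simp: components_def quotient_def Un_commute Int_commute)
  finally have eq: "components (A \<union> B) (r \<union> s) = components A r \<union> components B s" .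
  have in_A: "X \<subseteq> A \<and> X \<noteq> {}" if "X \<in> components A r" "r \<subseteq> A \<times> A" for X A and r :: "nat rel"
  proof -
    let ?H = "hasse A r \<union> (hasse A r)\<inverse>"
    have "y \<in> A" if "(x, y) \<in> ?H\<^sup>*" "x \<in> A" for x y
      using that by (induction rule: rtrancl_induct) (use \<open>r \<subseteq> A \<times> A\<close> in \<open>auto simp: hasse_def\<close>)
    then show ?thesis using that(1) by (auto simp: components_def quotient_def)
  qed
  have "components A r \<inter> components B s = {}"
    using in_A[OF _ assms(3)] in_A[OF _ assms(4)] assms(5) by blast
  moreover have "finite (components A r)" "finite (components B s)"
    using assms(1,2) by (auto simp: components_def quotient_def)
  ultimately show ?thesis unfolding eq by (simp add: card_Un_disjoint)
qed

text \<open>Replaces the encoding by even and odd numbers with a plain union when the ground sets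
  are already disjoint.\<close>

lemma class_of_Un:
  assumes "finite A" "partial_order_on A r" "finite B" "partial_order_on B s" "A \<inter> B = {}"
  shows "class_of (A \<union> B) (r \<union> s) = class_of A r + class_of B s"
proof -
  have iso: "poset_iso (poset_sum (A, r) (B, s)) (A \<union> B, r \<union> s)"
    by (rule poset_iso_sumI[where f = id and g = id]) (use assms in \<open>auto simp: map_prod.id\<close>)
  have "class_of A r + class_of B s = abs_poset_class (poset_sum (A, r) (B, s))"
    using plus_poset_class.abs_eq[OF poset_iso_refl[OF assms(1,2)] poset_iso_refl[OF assms(3,4)]]
    by (simp add: class_of_def)
  also have "\<dots> = abs_poset_class (A \<union> B, r \<union> s)"
    using class_of_eq_iff[OF poset_sum_valid[OF assms(1-4)], of "A \<union> B" "r \<union> s"] iso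
      partial_order_on_Un[OF assms(2,4,5)] assms(1,3)
    by (simp add: class_of_def)
  finally show ?thesis by (simp add: class_of_def)
qed

text \<open>Representatives are moved apart onto even and odd numbers.\<close>

lemma poset_class_disjoint_cases:
  obtains A r B s where "finite A" "partial_order_on A r" "p = class_of A r"
    "finite B" "partial_order_on B s" "q = class_of B s" "A \<inter> B = {}"
proof -
  obtain A r where A: "finite A" "partial_order_on A r" "p = class_of A r"
    by (rule poset_class_cases)
  obtain B s where B: "finite B" "partial_order_on B s" "q = class_of B s"
    by (rule poset_class_cases)
  have im: "finite (f ` A) \<and> partial_order_on (f ` A) (map_prod f f ` r) \<and>
      class_of A r = class_of (f ` A) (map_prod f f ` r)"
    if "finite A" "partial_order_on A r" "inj_on f A" for f :: "nat \<Rightarrow> nat" and A r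
  proof -
    have po: "partial_order_on (f ` A) (map_prod f f ` r)"
      using that by (rule partial_order_on_image)
    have "poset_iso (A, r) (f ` A, map_prod f f ` r)"
      by (rule poset_iso_imageI[OF that refl refl])
    then show ?thesis using class_of_eq_iff[OF that(1,2) finite_imageI[OF that(1)] po] po that(1) by simp
  qed
  let ?f = "\<lambda>x :: nat. 2 * x" and ?g = "\<lambda>x :: nat. 2 * x + 1"
  have "?f ` A \<inter> ?g ` B = {}" by (auto simp: even_neq_odd)
  then show thesis
    using that[of "?f ` A" "map_prod ?f ?f ` r" "?g ` B" "map_prod ?g ?g ` s"]
      im[OF A(1,2), of ?f] im[OF B(1,2), of ?g] A(3) B(3)
    by (simp add: inj_on_def)
qed

lemma rk_add: "rk (p + q) = rk p + rk q"
proof -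
  obtain A r B s where A: "finite A" "partial_order_on A r" "p = class_of A r"
    and B: "finite B" "partial_order_on B s" "q = class_of B s" and dis: "A \<inter> B = {}"
    by (rule poset_class_disjoint_cases)
  have "p + q = class_of (A \<union> B) (r \<union> s)"
    unfolding A(3) B(3) class_of_Un[OF A(1,2) B(1,2) dis] ..
  then show ?thesis
    using A B dis card_components_le[OF A(1), of r] card_components_le[OF B(1), of s]
      card_components_Un[OF A(1) B(1) partial_order_onD(4)[OF A(2)] partial_order_onD(4)[OF B(2)] dis]
      partial_order_on_Un[OF A(2) B(2) dis]
    by (simp add: rk_class_of card_Un_disjoint)
qed

section \<open>Chain coefficients as sums over order-preserving maps\<close>

text \<open>A chain of ideals labelled by \<open>js\<close> is the map sending each block to its
  label. The induction splits off the fibre over the least label, which is an ideal; what remains is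
  a map on the complement with larger labels.\<close>

lemma chain_coeff_eq_sum_maps:
  fixes js :: "nat list"
  assumes "finite A" "partial_order_on A r" "B \<subseteq> A" "sorted_wrt (<) js"
  shows "(chain_coeff (map c js) (subposet_class r B) :: 'k::field poly fract) =
    (\<Sum>f | f \<in> B \<rightarrow>\<^sub>E set js \<and> (\<forall>x\<in>B. \<forall>y\<in>B. (x, y) \<in> r \<longrightarrow> f x \<le> f y) \<and>
        (\<forall>j\<in>set js. card {x\<in>B. f x = j} = c j).
      \<Prod>j\<in>set js. qvar ^ rk (subposet_class r {x\<in>B. f x = j}))"
  using assms(3,4)
proof (induction js arbitrary: B)
  case Nil
  \<comment> \<open>Without labels there is a map only on the empty set, namely the everywhere
    undefined extensional function.\<close>
  have "{f. f \<in> B \<rightarrow>\<^sub>E set [] \<and> (\<forall>x\<in>B. \<forall>y\<in>B. (x, y) \<in> r \<longrightarrow> f x \<le> f y) \<and>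
      (\<forall>j\<in>set []. card {x\<in>B. f x = j} = c j)} = (if B = {} then {\<lambda>_. undefined} else {})"
    by (auto simp: PiE_eq_empty_iff)
  then show ?case using subposet_eq_0_iff[OF assms(1,2) Nil.prems(1)] by simp
next
  case (Cons j js)
  define M where "M js B = {f. f \<in> B \<rightarrow>\<^sub>E set js \<and>
      (\<forall>x\<in>B. \<forall>y\<in>B. (x, y) \<in> r \<longrightarrow> f x \<le> f y) \<and> (\<forall>j\<in>set js. card {x\<in>B. f x = j} = c j)}" for js B
  let ?q = "\<lambda>S. qvar ^ rk (subposet_class r S) :: 'k poly fract"
  let ?I = "{S. poset_ideal B r S \<and> card S = c j}"
  have j: "i \<in> set js \<Longrightarrow> j < i" for i using Cons.prems by auto
  have finB: "finite B" using Cons.prems(1) assms(1) by (rule finite_subset)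
  have finM: "finite (M js B)" if "finite B" for js B
    by (rule finite_subset[of _ "B \<rightarrow>\<^sub>E set js"]) (use that in \<open>auto simp: M_def intro!: finite_PiE\<close>)
  have "chain_coeff (map c (j # js)) (subposet_class r B) =
      (\<Sum>S\<in>?I. ?q S * chain_coeff (map c js) (subposet_class r (B - S)))"
    using chain_coeff_Cons_subposet[OF assms(1,2) Cons.prems(1)] by simp
  also have "\<dots> = (\<Sum>S\<in>?I. \<Sum>g\<in>M js (B - S). ?q S * (\<Prod>i\<in>set js. ?q {x\<in>B - S. g x = i}))"
  proof (rule sum.cong[OF refl])
    fix S
    have "B - S \<subseteq> A" "sorted_wrt (<) js" using Cons.prems by auto
    from Cons.IH[OF this]
    show "?q S * chain_coeff (map c js) (subposet_class r (B - S)) =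
      (\<Sum>g\<in>M js (B - S). ?q S * (\<Prod>i\<in>set js. ?q {x\<in>B - S. g x = i}))"
      by (simp add: M_def sum_distrib_left)
  qed
  also have "\<dots> = (\<Sum>(S, g)\<in>(SIGMA S : ?I. M js (B - S)).
      ?q S * (\<Prod>i\<in>set js. ?q {x\<in>B - S. g x = i}))"
  proof (rule sum.Sigma)
    show "finite ?I" using finite_subset[OF _ finite_poset_ideals[OF finB, of r]] by (simp add: Collect_mono)
  qed (use finM finB in auto)
  also have "\<dots> = (\<Sum>f\<in>M (j # js) B. \<Prod>i\<in>set (j # js). ?q {x\<in>B. f x = i})"
  \<comment> \<open>Gluing gives the value \<open>j\<close> on \<open>S\<close> and \<open>g\<close>
    elsewhere; the inverse cuts a map at its fibre over \<open>j\<close>.\<close>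
  proof (rule sum.reindex_bij_witness[where j = "\<lambda>(S, g) x. if x \<in> S then j else g x"
        and i = "\<lambda>f. ({x\<in>B. f x = j}, restrict f (B - {x\<in>B. f x = j}))"])
    fix a assume "a \<in> (SIGMA S : ?I. M js (B - S))"
    then obtain S g where a: "a = (S, g)" and S: "poset_ideal B r S" "card S = c j"
      and g: "g \<in> M js (B - S)" by auto
    define f where "f = (\<lambda>x. if x \<in> S then j else g x)"
    have SB: "S \<subseteq> B" using S(1) by (rule poset_ideal_subset)
    have gj: "g x \<in> set js" if "x \<in> B" "x \<notin> S" for x using g that by (auto simp: M_def)
    have gj': "g x \<noteq> j \<and> j < g x" if "x \<in> B" "x \<notin> S" for x using j[OF gj[OF that]] by auto
    have gu: "g x = undefined" if "x \<notin> B" for x using g that by (auto simp: M_def PiE_iff extensional_def)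
    have fS: "{x\<in>B. f x = j} = S" using SB gj' by (auto simp: f_def)
    have fi: "{x\<in>B. f x = i} = {x\<in>B - S. g x = i}" if "i \<in> set js" for i
      using SB j[OF that] by (auto simp: f_def)
    have "restrict f (B - S) = g"
      using g by (auto simp: f_def M_def fun_eq_iff PiE_iff extensional_def restrict_def)
    then show "({x\<in>B. (case a of (S, g) \<Rightarrow> \<lambda>x. if x \<in> S then j else g x) x = j},
        restrict (case a of (S, g) \<Rightarrow> \<lambda>x. if x \<in> S then j else g x)
          (B - {x\<in>B. (case a of (S, g) \<Rightarrow> \<lambda>x. if x \<in> S then j else g x) x = j})) = a"
      using fS unfolding a f_def prod.case by simp
    \<comment> \<open>Elements of \<open>S\<close> carry the least label. If \<open>x\<close> is
      outside the ideal \<open>S\<close>, so is everything above \<open>x\<close>, and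
      \<open>g\<close> decides.\<close>
    have "f x \<le> f y" if "x \<in> B" "y \<in> B" "(x, y) \<in> r" for x y
    proof (cases "x \<in> S")
      case True
      then show ?thesis using gj'[of y] that by (auto simp: f_def)
    next
      case False
      then have "y \<notin> S" using S(1) that by (auto simp: poset_ideal_def)
      then show ?thesis using False g that by (auto simp: f_def M_def)
    qed
    moreover have "f \<in> B \<rightarrow>\<^sub>E set (j # js)" using gj gu SB by (auto simp: f_def)
    moreover have "card {x\<in>B. f x = i} = c i" if "i \<in> set (j # js)" for i
    proof (cases "i = j")
      case True
      then show ?thesis using fS S(2) by simp
    next
      case False
      then have "i \<in> set js" using that by simp
      then show ?thesis using g by (simp add: fi M_def)
    qed
    ultimately show "(case a of (S, g) \<Rightarrow> \<lambda>x. if x \<in> S then j else g x) \<in> M (j # js) B"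
      by (simp add: a M_def f_def)
    have "j \<notin> set js" using j by blast
    then have "(\<Prod>i\<in>set (j # js). ?q {x\<in>B. f x = i}) = ?q S * (\<Prod>i\<in>set js. ?q {x\<in>B - S. g x = i})"
      using fS fi by simp
    then show "(\<Prod>i\<in>set (j # js). ?q {x\<in>B. (case a of (S, g) \<Rightarrow> \<lambda>x. if x \<in> S then j else g x) x = i}) =
      (case a of (S, g) \<Rightarrow> ?q S * (\<Prod>i\<in>set js. ?q {x\<in>B - S. g x = i}))"
      unfolding a prod.case f_def .
  next
    fix f assume f: "f \<in> M (j # js) B"
    define S where "S = {x\<in>B. f x = j}"
    have fu: "f x = undefined" if "x \<notin> B" for x using f that by (auto simp: M_def PiE_iff extensional_def)
    have "(\<lambda>x. if x \<in> S then j else restrict f (B - S) x) = f"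
      using fu by (auto simp: S_def fun_eq_iff)
    then show "(case ({x\<in>B. f x = j}, restrict f (B - {x\<in>B. f x = j})) of (S, g) \<Rightarrow>
        \<lambda>x. if x \<in> S then j else g x) = f"
      unfolding S_def prod.case .
    have fj: "f x \<in> set js" if "x \<in> B - S" for x using f that by (auto simp: M_def S_def PiE_iff)
    \<comment> \<open>An element below a member of \<open>S\<close> has value at most
      \<open>j\<close>, while all values outside \<open>S\<close> exceed \<open>j\<close>.\<close>
    have "poset_ideal B r S"
      unfolding poset_ideal_def
    proof (intro conjI notI)
      assume "\<exists>x\<in>B - S. \<exists>y\<in>S. (x, y) \<in> r"
      then obtain x y where "x \<in> B - S" "y \<in> S" "(x, y) \<in> r" by blast
      then have "f x \<le> j" using f by (auto simp: M_def S_def)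
      then show False using j fj[OF \<open>x \<in> B - S\<close>] by fastforce
    qed (auto simp: S_def)
    moreover have "card S = c j" using f by (simp add: M_def S_def)
    moreover have "restrict f (B - S) \<in> M js (B - S)"
    proof -
      have "card {x\<in>B - S. restrict f (B - S) x = i} = c i" if "i \<in> set js" for i
      proof -
        have "{x\<in>B - S. restrict f (B - S) x = i} = {x\<in>B. f x = i}"
          using j[OF that] by (auto simp: S_def)
        then show ?thesis using f that by (simp add: M_def)
      qed
      then show ?thesis using f fj by (auto simp: M_def)
    qed
    ultimately show "({x\<in>B. f x = j}, restrict f (B - {x\<in>B. f x = j})) \<in> (SIGMA S : ?I. M js (B - S))"
      by (simp add: S_def)
  qed
  finally show ?case by (simp add: M_def)
qed

text \<open>The sorted keys of \<open>m\<close> serve as labels and its exponents as block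
  sizes.\<close>

lemma qsym_series_class_image:
  assumes "finite A" "partial_order_on A r"
  shows "(qsym_series (class_image (class_of A r)) m :: 'k::field poly fract) =
    (if 0 \<in> Poly_Mapping.keys m then 0 else
    (\<Sum>f\<in>op_maps A r m. \<Prod>j\<in>Poly_Mapping.keys m. qvar ^ rk (subposet_class r {x\<in>A. f x = j})))"
proof -
  let ?js = "sorted_list_of_set (Poly_Mapping.keys m)"
  have "op_maps A r m = {f. f \<in> A \<rightarrow>\<^sub>E set ?js \<and> (\<forall>x\<in>A. \<forall>y\<in>A. (x, y) \<in> r \<longrightarrow> f x \<le> f y) \<and>
        (\<forall>j\<in>set ?js. card {x\<in>A. f x = j} = Poly_Mapping.lookup m j)}"
    unfolding op_maps_def map_monomial_eq_iff[OF assms(1)] by (auto simp: PiE_iff)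
  moreover have "(chain_coeff (exponent_list m) (class_of A r) :: 'k poly fract) =
      chain_coeff (map (Poly_Mapping.lookup m) ?js) (subposet_class r A)"
    by (simp add: exponent_list_def Restr_ground[OF assms(2)])
  ultimately have "(chain_coeff (exponent_list m) (class_of A r) :: 'k poly fract) =
      (\<Sum>f\<in>op_maps A r m. \<Prod>j\<in>Poly_Mapping.keys m. qvar ^ rk (subposet_class r {x\<in>A. f x = j}))"
    using chain_coeff_eq_sum_maps[OF assms subset_refl, of ?js "Poly_Mapping.lookup m"] by simp
  then show ?thesis
    by (simp add: qsym_series_eq lookup_class_image parts_composition[OF exponent_list_pos])
qed

section \<open>Multiplicativity of the candidate\<close>

text \<open>No relation connects \<open>A\<close> with \<open>B\<close>, so order preservation is
  checked on each side separately, and the two monomials multiply.\<close>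

lemma op_maps_Un_bij:
  assumes "finite A" "partial_order_on A r" "finite B" "partial_order_on B s" "A \<inter> B = {}"
  shows "bij_betw (\<lambda>f. (restrict f A, restrict f B)) (op_maps (A \<union> B) (r \<union> s) m)
    (\<Union>(a, b)\<in>{(a, b). a + b = m}. op_maps A r a \<times> op_maps B s b)"
proof (rule bij_betw_byWitness[where f' = "\<lambda>(g, h) x. if x \<in> A then g x else h x"])
  have r: "r \<subseteq> A \<times> A" and s: "s \<subseteq> B \<times> B" using assms(2,4) by (auto dest: partial_order_onD(4))
  have cont: "map_monomial (A \<union> B) f = map_monomial A f + map_monomial B f" for f
    unfolding map_monomial_def by (rule sum.union_disjoint[OF assms(1,3,5)])
  show "\<forall>f\<in>op_maps (A \<union> B) (r \<union> s) m.
      (case (restrict f A, restrict f B) of (g, h) \<Rightarrow> \<lambda>x. if x \<in> A then g x else h x) = f"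
    by (auto simp: op_maps_def fun_eq_iff extensional_def)
  show "\<forall>x\<in>\<Union>(a, b)\<in>{(a, b). a + b = m}. op_maps A r a \<times> op_maps B s b.
      (restrict (case x of (g, h) \<Rightarrow> \<lambda>x. if x \<in> A then g x else h x) A,
       restrict (case x of (g, h) \<Rightarrow> \<lambda>x. if x \<in> A then g x else h x) B) = x"
    using assms(5) by (auto simp: op_maps_def fun_eq_iff extensional_def restrict_def)
  show "(\<lambda>f. (restrict f A, restrict f B)) ` op_maps (A \<union> B) (r \<union> s) m \<subseteq>
      (\<Union>(a, b)\<in>{(a, b). a + b = m}. op_maps A r a \<times> op_maps B s b)"
  proof clarify
    fix f assume f: "f \<in> op_maps (A \<union> B) (r \<union> s) m"
    have "map_monomial A (restrict f A) = map_monomial A f" "map_monomial B (restrict f B) = map_monomial B f"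
      by (auto intro: map_monomial_cong)
    then have "restrict f A \<in> op_maps A r (map_monomial A f)" "restrict f B \<in> op_maps B s (map_monomial B f)"
      using f by (auto simp: op_maps_def)
    moreover have "map_monomial A f + map_monomial B f = m" using f cont by (simp add: op_maps_def)
    ultimately show "(restrict f A, restrict f B) \<in>
        (\<Union>(a, b)\<in>{(a, b). a + b = m}. op_maps A r a \<times> op_maps B s b)" by blast
  qed
  show "(\<lambda>(g, h) x. if x \<in> A then g x else h x) `
      (\<Union>(a, b)\<in>{(a, b). a + b = m}. op_maps A r a \<times> op_maps B s b) \<subseteq> op_maps (A \<union> B) (r \<union> s) m"
  proof clarify
    fix a b g h assume ab: "m = a + b" and g: "g \<in> op_maps A r a" and h: "h \<in> op_maps B s b"
    let ?f = "\<lambda>x. if x \<in> A then g x else h x"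
    have "map_monomial A ?f = map_monomial A g" "map_monomial B ?f = map_monomial B h"
      using assms(5) by (auto intro!: map_monomial_cong)
    then have "map_monomial (A \<union> B) ?f = a + b" using g h by (simp add: cont op_maps_def)
    moreover have "?f x \<le> ?f y" if "(x, y) \<in> r \<union> s" for x y
      using that r s g h assms(5) by (auto simp: op_maps_def)
    moreover have "?f \<in> extensional (A \<union> B)" using g h by (auto simp: op_maps_def extensional_def)
    ultimately show "?f \<in> op_maps (A \<union> B) (r \<union> s) (a + b)" by (simp add: op_maps_def)
  qed
qed

text \<open>Fibres over indices outside \<open>keys m\<close> are empty and have weight 1. This
  allows the weights of both factors to be taken over the keys of the product monomial.\<close>

lemma prod_fibres_superset:
  assumes "finite A" "f \<in> op_maps A r m" "Poly_Mapping.keys m \<subseteq> J" "finite J"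
  shows "(\<Prod>j\<in>Poly_Mapping.keys m. qvar ^ rk (subposet_class r {x\<in>A. f x = j})) =
    (\<Prod>j\<in>J. qvar ^ rk (subposet_class r {x\<in>A. f x = j}))"
proof (rule prod.mono_neutral_left[OF assms(4,3)], rule ballI)
  fix j assume "j \<in> J - Poly_Mapping.keys m"
  then have "{x\<in>A. f x = j} = {}" using assms(1,2) by (auto simp: op_maps_def keys_map_monomial)
  then have "subposet_class r {x\<in>A. f x = j} = 0"
    by (simp only:) (simp add: class_of_empty)
  then show "qvar ^ rk (subposet_class r {x\<in>A. f x = j}) = 1"
    by (simp add: rk_0)
qed

lemma fibre_rk_Un:
  assumes "finite A" "partial_order_on A r" "finite B" "partial_order_on B s" "A \<inter> B = {}"
  shows "rk (subposet_class (r \<union> s) {x\<in>A \<union> B. f x = j}) =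
    rk (subposet_class r {x\<in>A. f x = j}) + rk (subposet_class s {x\<in>B. f x = j})"
proof -
  let ?F = "\<lambda>A. {x\<in>A. f x = j}"
  have r: "r \<subseteq> A \<times> A" and s: "s \<subseteq> B \<times> B" using assms(2,4) by (auto dest: partial_order_onD(4))
  have "Restr (r \<union> s) (?F (A \<union> B)) = Restr r (?F A) \<union> Restr s (?F B)"
    using r s assms(5) by blast
  moreover have "?F (A \<union> B) = ?F A \<union> ?F B" by blast
  moreover have "class_of (?F A \<union> ?F B) (Restr r (?F A) \<union> Restr s (?F B)) =
      subposet_class r (?F A) + subposet_class s (?F B)"
    using assms by (intro class_of_Un partial_order_on_Restr[of A] partial_order_on_Restr[of B]) auto
  ultimately show ?thesis by (simp add: rk_add)
qed

text \<open>Maps on a disjoint union are pairs of maps, and the weight of a fibre factors by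
  additivity of the rank.\<close>

lemma qsym_series_class_image_add:
  "qsym_series (class_image (p + q) :: 'k::field poly fract qsym) =
    series_mult (qsym_series (class_image p)) (qsym_series (class_image q))"
proof
  fix m :: "nat \<Rightarrow>\<^sub>0 nat"
  obtain A r B s where A: "finite A" "partial_order_on A r" "p = class_of A r"
    and B: "finite B" "partial_order_on B s" "q = class_of B s" and dis: "A \<inter> B = {}"
    by (rule poset_class_disjoint_cases)
  have pq: "p + q = class_of (A \<union> B) (r \<union> s)"
    unfolding A(3) B(3) class_of_Un[OF A(1,2) B(1,2) dis] ..
  have AB: "finite (A \<union> B)" "partial_order_on (A \<union> B) (r \<union> s)"
    using A B partial_order_on_Un[OF A(2) B(2) dis] by auto
  let ?D = "{(a, b). a + b = m}"
  let ?P = "\<lambda>A r J f. \<Prod>j\<in>J. qvar ^ rk (subposet_class r {x\<in>A. f x = j}) :: 'k poly fract"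
  let ?W = "\<lambda>A r m. \<Sum>f\<in>op_maps A r m. ?P A r (Poly_Mapping.keys m) f"
  have keys: "Poly_Mapping.keys (a + b) = Poly_Mapping.keys a \<union> Poly_Mapping.keys b"
    for a b :: "nat \<Rightarrow>\<^sub>0 nat" by (auto simp: in_keys_iff lookup_add)
  show "qsym_series (class_image (p + q) :: 'k poly fract qsym) m =
    series_mult (qsym_series (class_image p)) (qsym_series (class_image q)) m"
  proof (cases "0 \<in> Poly_Mapping.keys m")
    case True
    \<comment> \<open>The index 0 must occur in \<open>a\<close> or in \<open>b\<close>, which makes
      one factor vanish.\<close>
    have "qsym_series (class_image p :: 'k poly fract qsym) a * qsym_series (class_image q) b = 0"
      if "a + b = m" for a b
      using that True keys[of a b] by (auto simp: qsym_series_eq)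
    then have "series_mult (qsym_series (class_image p :: 'k poly fract qsym)) (qsym_series (class_image q)) m = 0"
      unfolding series_mult_def by (intro sum.neutral) auto
    then show ?thesis using True by (simp add: qsym_series_eq)
  next
    case False
    have "qsym_series (class_image (p + q)) m = ?W (A \<union> B) (r \<union> s) m"
      unfolding pq using False by (simp add: qsym_series_class_image[OF AB])
    also have "\<dots> = (\<Sum>f\<in>op_maps (A \<union> B) (r \<union> s) m.
        (case (restrict f A, restrict f B) of (g, h) \<Rightarrow>
          ?P A r (Poly_Mapping.keys m) g * ?P B s (Poly_Mapping.keys m) h))"
    proof (rule sum.cong[OF refl])
      fix f :: "nat \<Rightarrow> nat"
      have "{x\<in>A. restrict f A x = j} = {x\<in>A. f x = j}" "{x\<in>B. restrict f B x = j} = {x\<in>B. f x = j}" for j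
        by auto
      then show "?P (A \<union> B) (r \<union> s) (Poly_Mapping.keys m) f = (case (restrict f A, restrict f B) of
          (g, h) \<Rightarrow> ?P A r (Poly_Mapping.keys m) g * ?P B s (Poly_Mapping.keys m) h)"
        unfolding fibre_rk_Un[OF A(1,2) B(1,2) dis] prod.case by (simp add: power_add prod.distrib)
    qed
    also have "\<dots> = (\<Sum>(g, h)\<in>(\<Union>(a, b)\<in>?D. op_maps A r a \<times> op_maps B s b).
          ?P A r (Poly_Mapping.keys m) g * ?P B s (Poly_Mapping.keys m) h)"
      by (rule sum.reindex_bij_betw[OF op_maps_Un_bij[OF A(1,2) B(1,2) dis]])
    \<comment> \<open>The union is disjoint because \<open>g\<close> and \<open>h\<close> determine
      their monomials \<open>a\<close> and \<open>b\<close>.\<close>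
    also have "\<dots> = (\<Sum>d\<in>?D. \<Sum>(g, h)\<in>(case d of (a, b) \<Rightarrow> op_maps A r a \<times> op_maps B s b).
          ?P A r (Poly_Mapping.keys m) g * ?P B s (Poly_Mapping.keys m) h)"
    proof (rule sum.UNION_disjoint[OF finite_poly_mapping_decompositions])
      show "\<forall>d\<in>?D. finite (case d of (a, b) \<Rightarrow> op_maps A r a \<times> op_maps B s b)"
        using finite_op_maps[OF A(1)] finite_op_maps[OF B(1)] by auto
      show "\<forall>d\<in>?D. \<forall>d'\<in>?D. d \<noteq> d' \<longrightarrow> (case d of (a, b) \<Rightarrow> op_maps A r a \<times> op_maps B s b) \<inter>
          (case d' of (a, b) \<Rightarrow> op_maps A r a \<times> op_maps B s b) = {}"
        by (auto simp: op_maps_def)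
    qed
    also have "\<dots> = (\<Sum>(a, b)\<in>?D. qsym_series (class_image p) a * qsym_series (class_image q) b)"
    proof (rule sum.cong[OF refl], clarify)
      fix a b assume m: "m = a + b"
      have J: "Poly_Mapping.keys a \<subseteq> Poly_Mapping.keys m" "Poly_Mapping.keys b \<subseteq> Poly_Mapping.keys m"
        unfolding m keys by auto
      have "0 \<notin> Poly_Mapping.keys a" "0 \<notin> Poly_Mapping.keys b" using J False by auto
      then have "qsym_series (class_image p) a * qsym_series (class_image q) b = ?W A r a * ?W B s b"
        unfolding A(3) B(3) by (simp add: qsym_series_class_image[OF A(1,2)] qsym_series_class_image[OF B(1,2)])
      also have "?W A r a = (\<Sum>g\<in>op_maps A r a. ?P A r (Poly_Mapping.keys m) g)"
        by (intro sum.cong refl prod_fibres_superset[OF A(1) _ J(1)]) auto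
      also have "?W B s b = (\<Sum>h\<in>op_maps B s b. ?P B s (Poly_Mapping.keys m) h)"
        by (intro sum.cong refl prod_fibres_superset[OF B(1) _ J(2)]) auto
      finally show "(\<Sum>(g, h)\<in>op_maps A r a \<times> op_maps B s b. ?P A r (Poly_Mapping.keys (a + b)) g *
          ?P B s (Poly_Mapping.keys (a + b)) h) =
          qsym_series (class_image p) a * qsym_series (class_image q) b"
        unfolding m by (simp add: sum_product sum.cartesian_product)
    qed
    finally show ?thesis by (simp add: series_mult_def)
  qed
qed

lemma qsym_series_lin_ext:
  "qsym_series (lin_ext g x) m = lin_form (\<lambda>p. qsym_series (g p) m) x"
  by (simp add: qsym_series_eq lookup_lin_ext lin_form_def)

lemma poly_mapping_eq_sum_single:
  "x = (\<Sum>a\<in>Poly_Mapping.keys x. Poly_Mapping.single a (Poly_Mapping.lookup x a))"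
  by (rule poly_mapping_eqI) (simp add: lookup_sum lookup_single when_def in_keys_iff)

lemma lin_form_single: "lin_form g (Poly_Mapping.single a c) = c * g a"
  by (simp add: lin_form_def)

lemma lin_form_mult:
  "lin_form g (x * y) = (\<Sum>a\<in>Poly_Mapping.keys x. \<Sum>b\<in>Poly_Mapping.keys y.
    Poly_Mapping.lookup x a * Poly_Mapping.lookup y b * g (a + b))"
proof -
  have "x * y = (\<Sum>a\<in>Poly_Mapping.keys x. Poly_Mapping.single a (Poly_Mapping.lookup x a)) *
      (\<Sum>b\<in>Poly_Mapping.keys y. Poly_Mapping.single b (Poly_Mapping.lookup y b))"
    by (simp only: poly_mapping_eq_sum_single[symmetric])
  also have "\<dots> = (\<Sum>a\<in>Poly_Mapping.keys x. \<Sum>b\<in>Poly_Mapping.keys y.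
      Poly_Mapping.single (a + b) (Poly_Mapping.lookup x a * Poly_Mapping.lookup y b))"
    by (simp only: sum_product mult_single)
  finally have "x * y = (\<Sum>a\<in>Poly_Mapping.keys x. \<Sum>b\<in>Poly_Mapping.keys y.
      Poly_Mapping.single (a + b) (Poly_Mapping.lookup x a * Poly_Mapping.lookup y b))" .
  then show ?thesis by (simp add: lin_form_sum lin_form_single)
qed

text \<open>Bilinear extension of multiplicativity from classes to the whole algebra.\<close>

lemma qsym_series_mult:
  "qsym_series (lin_ext class_image (x * y) :: 'k::field poly fract qsym) =
    series_mult (qsym_series (lin_ext class_image x)) (qsym_series (lin_ext class_image y))"
proof
  fix m :: "nat \<Rightarrow>\<^sub>0 nat"
  let ?h = "\<lambda>p. qsym_series (class_image p :: 'k poly fract qsym)"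
  let ?D = "{(a, b). a + b = m}"
  let ?x = "Poly_Mapping.lookup x" and ?y = "Poly_Mapping.lookup y"
  have "qsym_series (lin_ext class_image (x * y)) m =
      (\<Sum>p\<in>Poly_Mapping.keys x. \<Sum>q\<in>Poly_Mapping.keys y. \<Sum>d\<in>?D.
        (?x p * ?h p (fst d)) * (?y q * ?h q (snd d)))"
    unfolding qsym_series_lin_ext lin_form_mult qsym_series_class_image_add
    by (simp add: series_mult_def sum_distrib_left split_def mult_ac)
  also have "\<dots> = (\<Sum>d\<in>?D. \<Sum>p\<in>Poly_Mapping.keys x. \<Sum>q\<in>Poly_Mapping.keys y.
        (?x p * ?h p (fst d)) * (?y q * ?h q (snd d)))"
    by (subst sum.swap) (simp add: sum.swap[of _ ?D])
  also have "\<dots> = series_mult (qsym_series (lin_ext class_image x)) (qsym_series (lin_ext class_image y)) m"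
    by (simp add: series_mult_def qsym_series_lin_ext lin_form_def sum_product split_def)
  finally show "qsym_series (lin_ext class_image (x * y)) m =
    series_mult (qsym_series (lin_ext class_image x)) (qsym_series (lin_ext class_image y)) m" .
qed

lemma Psi_q_eq: "Psi_q = lin_ext class_image"
  by (rule Psi_q_eqI) (rule qsym_series_mult)

section \<open>Faces of poset cones\<close>

lemma lookup_scaleR: "Poly_Mapping.lookup (c *\<^sub>R x) i = c *\<^sub>R Poly_Mapping.lookup x i"
proof -
  have "finite {i. c *\<^sub>R Poly_Mapping.lookup x i \<noteq> 0}"
    by (rule finite_subset[of _ "Poly_Mapping.keys x"]) (auto simp: in_keys_iff)
  then show ?thesis by (simp add: scaleR_poly_mapping_def)
qed

lemma linear_dot: "linear (dot n \<omega>)"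
  by (rule linearI)
    (simp_all add: dot_def lookup_add lookup_scaleR sum.distrib sum_distrib_left algebra_simps)

lemma lookup_unit_vec: "Poly_Mapping.lookup (unit_vec i) j = (if i = j then 1 else 0)"
  by (simp add: unit_vec_def lookup_single when_def)

lemma dot_unit_vec: "i \<in> {1..n} \<Longrightarrow> dot n \<omega> (unit_vec i) = Poly_Mapping.lookup \<omega> i"
  by (simp add: dot_def lookup_unit_vec if_distrib cong: if_cong)

lemma convex_coneI:
  assumes "0 \<in> S" "\<And>x y. x \<in> S \<Longrightarrow> y \<in> S \<Longrightarrow> x + y \<in> S"
    "\<And>x c. x \<in> S \<Longrightarrow> 0 \<le> c \<Longrightarrow> c *\<^sub>R x \<in> S"
  shows "convex_cone S"
  using assms by (simp add: convex_cone_iff)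

section \<open>Linear functionals and faces of convex cones\<close>

text \<open>The points satisfying both conclusions form a convex cone containing \<open>G\<close>.
  Closure under sums holds because two nonpositive values add to 0 only if both are 0.\<close>

lemma linear_nonpos_cone_hull:
  fixes \<phi> :: "'a::real_vector \<Rightarrow> real"
  assumes "linear \<phi>" "\<And>g. g \<in> G \<Longrightarrow> \<phi> g \<le> 0" "x \<in> convex_cone hull G"
  shows "\<phi> x \<le> 0" "\<phi> x = 0 \<Longrightarrow> x \<in> convex_cone hull {g\<in>G. \<phi> g = 0}"
proof -
  let ?H = "convex_cone hull {g\<in>G. \<phi> g = 0}"
  let ?S = "{x. \<phi> x \<le> 0 \<and> (\<phi> x = 0 \<longrightarrow> x \<in> ?H)}"
  interpret \<phi>: linear \<phi> by fact
  have "convex_cone ?S"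
  proof (rule convex_coneI)
    show "0 \<in> ?S" using convex_cone_hull_contains_0 by (simp add: \<phi>.zero)
    fix x y assume xy: "x \<in> ?S" "y \<in> ?S"
    then show "x + y \<in> ?S" by (auto simp: \<phi>.add intro: convex_cone_hull_add)
  next
    fix x and c :: real assume "x \<in> ?S" "0 \<le> c"
    then show "c *\<^sub>R x \<in> ?S"
      using convex_cone_hull_contains_0
      by (auto simp: \<phi>.scale mult_nonneg_nonpos intro: convex_cone_hull_mul)
  qed
  moreover have "G \<subseteq> ?S" using assms(2) by (auto intro: hull_inc)
  ultimately have "convex_cone hull G \<subseteq> ?S" by (intro hull_minimal)
  then show "\<phi> x \<le> 0" "\<phi> x = 0 \<Longrightarrow> x \<in> ?H" using assms(3) by auto
qed

text \<open>A combination of nonpositive values with positive weights vanishes only if both values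
  do.\<close>

lemma zero_set_face_of:
  fixes \<phi> :: "'a::real_vector \<Rightarrow> real"
  assumes "linear \<phi>" "\<And>x. x \<in> C \<Longrightarrow> \<phi> x \<le> 0" "convex C"
  shows "{x\<in>C. \<phi> x = 0} face_of C"
proof -
  interpret \<phi>: linear \<phi> by fact
  have "a \<in> {x\<in>C. \<phi> x = 0} \<and> b \<in> {x\<in>C. \<phi> x = 0}"
    if "a \<in> C" "b \<in> C" "x \<in> {x\<in>C. \<phi> x = 0}" "x \<in> open_segment a b" for a b x
  proof -
    obtain u where u: "0 < u" "u < 1" "x = (1 - u) *\<^sub>R a + u *\<^sub>R b"
      using \<open>x \<in> open_segment a b\<close> by (auto simp: in_segment)
    have "(1 - u) * \<phi> a + u * \<phi> b = 0" using that(3) u(3) by (simp add: \<phi>.add \<phi>.scale)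
    moreover have "(1 - u) * \<phi> a \<le> 0" "u * \<phi> b \<le> 0"
      using u assms(2) that(1,2) by (auto simp: mult_nonneg_nonpos)
    ultimately have "(1 - u) * \<phi> a = 0" "u * \<phi> b = 0" by linarith+
    then show ?thesis using u that by auto
  qed
  moreover have "convex {x\<in>C. \<phi> x = 0}"
    unfolding convex_def using assms(3) by (auto simp: \<phi>.add \<phi>.scale convexD)
  moreover have "{x\<in>C. \<phi> x = 0} \<subseteq> C" by blast
  ultimately show ?thesis unfolding face_of_def by blast
qed

text \<open>If the functional is positive at some \<open>z\<close> of the cone, adding
  \<open>z\<close> improves every point. Otherwise the maximum is 0, attained at the origin.\<close>

lemma argmax_linear_cone:
  fixes \<phi> :: "'a::real_vector \<Rightarrow> real"
  assumes "linear \<phi>" "convex_cone C"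
  shows "{x\<in>C. \<forall>y\<in>C. \<phi> y \<le> \<phi> x} = (if \<forall>y\<in>C. \<phi> y \<le> 0 then {x\<in>C. \<phi> x = 0} else {})"
proof -
  interpret \<phi>: linear \<phi> by fact
  have "\<not> (\<forall>y\<in>C. \<phi> y \<le> \<phi> x)" if "x \<in> C" "z \<in> C" "\<phi> z > 0" for x z
    using that convex_cone_add[OF assms(2) that(1,2)] by (force simp: \<phi>.add)
  moreover have "0 \<in> C" using assms(2) by (rule convex_cone_contains_0)
  ultimately show ?thesis by (force simp: \<phi>.zero not_le)
qed

text \<open>A nonzero point \<open>x\<close> of the face lies strictly between 0 and
  \<open>c\<close> times \<open>x\<close> for \<open>c > 1\<close>, so the face contains both ends.
  Factors up to 1 follow by convexity.\<close>

lemma face_of_cone_scale: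
  assumes "F face_of C" "convex_cone C" "x \<in> F"
  shows "0 \<in> F" "0 \<le> c \<Longrightarrow> c *\<^sub>R x \<in> F"
proof -
  have C: "0 \<in> C" "c *\<^sub>R x \<in> C" if "0 \<le> c" for c
    using assms convex_cone_contains_0 convex_cone_scaleR[OF assms(2) that] face_of_imp_subset by blast+
  have big: "0 \<in> F \<and> c *\<^sub>R x \<in> F" if "c > 1" for c
  proof (cases "x = 0")
    case False
    have "x = (1 - 1 / c) *\<^sub>R 0 + (1 / c) *\<^sub>R (c *\<^sub>R x)" using that by simp
    then have "x \<in> open_segment 0 (c *\<^sub>R x)"
      using that False unfolding in_segment by (intro conjI exI[of _ "1 / c"]) auto
    then show ?thesis using face_ofD[OF assms(1) _ C(1)[of 0] C(2)[of c] assms(3)] that by simp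
  qed (use assms in auto)
  show "0 \<in> F" using big[of 2] by simp
  have "c *\<^sub>R x \<in> F" if "0 \<le> c" "c \<le> 1" for c
    using convexD[OF face_of_imp_convex[OF assms(1)] \<open>0 \<in> F\<close> assms(3), of "1 - c" c] that by simp
  then show "0 \<le> c \<Longrightarrow> c *\<^sub>R x \<in> F" using big by (cases "c \<le> 1") auto
qed

text \<open>If a sum of two points of the cone lies in \<open>F\<close>, so do both summands. Hence
  writing a point of \<open>F\<close> in terms of generators involves only generators in
  \<open>F\<close>.\<close>

lemma face_of_cone_hull:
  assumes "F face_of (convex_cone hull G)" "F \<noteq> {}"
  shows "F = convex_cone hull (F \<inter> G)"
proof
  let ?C = "convex_cone hull G"
  have C: "convex_cone ?C" by (rule convex_cone_convex_cone_hull)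
  have FC: "F \<subseteq> ?C" using assms(1) by (rule face_of_imp_subset)
  note scale = face_of_cone_scale(2)[OF assms(1) C]
  have half: "(1/2) *\<^sub>R (x + y) = (1 - 1/2) *\<^sub>R x + (1/2) *\<^sub>R y" for x y :: 'a
    by (simp add: algebra_simps)
  \<comment> \<open>Half the sum is the midpoint of \<open>x\<close> and \<open>y\<close>; equal
    points are treated apart because their open segment is empty.\<close>
  have mid: "x \<in> F \<and> y \<in> F" if "x \<in> ?C" "y \<in> ?C" "x + y \<in> F" for x y
  proof (cases "x = y")
    case True
    have "(1/2) *\<^sub>R (x + y) \<in> F" using that(3) by (intro scale) auto
    also have "(1/2) *\<^sub>R (x + y) = x" using True by (simp add: scaleR_2[symmetric])
    finally show ?thesis using True by simp
  next
    case False
    have "(1/2) *\<^sub>R (x + y) \<in> open_segment x y"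
      unfolding in_segment half using False by (intro conjI exI[of _ "1/2"]) auto
    then show ?thesis using face_ofD[OF assms(1) _ that(1,2)] scale[OF that(3), of "1/2"] by simp
  qed
  have "convex_cone F"
  proof (rule convex_coneI)
    show "0 \<in> F" using assms(2) face_of_cone_scale(1)[OF assms(1) C] by blast
    fix x y assume "x \<in> F" "y \<in> F"
    then have "(1/2) *\<^sub>R (x + y) \<in> F"
      unfolding half using face_of_imp_convex[OF assms(1)] by (intro convexD) auto
    then show "x + y \<in> F" using scale[of "(1/2) *\<^sub>R (x + y)" 2] by simp
  qed (use assms scale in auto)
  then show "convex_cone hull (F \<inter> G) \<subseteq> F" by (intro hull_minimal) auto
  let ?S = "{x \<in> ?C. x \<in> F \<longrightarrow> x \<in> convex_cone hull (F \<inter> G)}"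
  have "convex_cone ?S"
  proof (rule convex_coneI)
    show "0 \<in> ?S" using convex_cone_hull_contains_0 by blast
    fix x y assume "x \<in> ?S" "y \<in> ?S"
    then show "x + y \<in> ?S" using mid by (auto intro: convex_cone_hull_add)
  next
    fix x and c :: real assume x: "x \<in> ?S" "0 \<le> c"
    show "c *\<^sub>R x \<in> ?S"
    \<comment> \<open>For \<open>c = 0\<close> the multiple is the origin and says nothing about
      \<open>x\<close>; otherwise one scales back by \<open>1 / c\<close>.\<close>
    proof (cases "c = 0")
      case True
      then show ?thesis using convex_cone_hull_contains_0 by auto
    next
      case False
      have "x \<in> F" if "c *\<^sub>R x \<in> F" using scale[OF that, of "1 / c"] x(2) False by simp
      then show ?thesis using x by (auto intro: convex_cone_hull_mul)
    qed
  qed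
  moreover have "G \<subseteq> ?S" by (auto intro: hull_inc)
  ultimately have "?C \<subseteq> ?S" by (intro hull_minimal)
  then show "F \<subseteq> convex_cone hull (F \<inter> G)" using FC by blast
qed

text \<open>A nonempty face is determined by the generators it contains. Without finiteness the sum
  over faces in \<open>cone_enumerator\<close> would be 0 by convention.\<close>

lemma finite_nonempty_faces_cone_hull:
  assumes "finite G"
  shows "finite {F. F face_of (convex_cone hull G) \<and> F \<noteq> {}}"
proof (rule finite_subset)
  show "{F. F face_of (convex_cone hull G) \<and> F \<noteq> {}} \<subseteq> (\<lambda>H. convex_cone hull H) ` Pow G"
    using face_of_cone_hull by blast
qed (use assms in simp)

section \<open>Root vectors, components and dimension\<close>

definition root_vecs :: "nat rel \<Rightarrow> (nat \<Rightarrow>\<^sub>0 real) set" where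
  "root_vecs r = {unit_vec i - unit_vec j | i j. (i, j) \<in> r \<and> i \<noteq> j}"

lemma poset_cone_eq: "poset_cone r = convex_cone hull (root_vecs r)"
  by (simp add: poset_cone_def root_vecs_def)

lemma finite_root_vecs: "finite r \<Longrightarrow> finite (root_vecs r)"
proof -
  assume "finite r"
  have "root_vecs r \<subseteq> (\<lambda>(i, j). unit_vec i - unit_vec j) ` r" by (auto simp: root_vecs_def)
  then show ?thesis using \<open>finite r\<close> by (rule finite_subset[OF _ finite_imageI])
qed

text \<open>Passing to the conical hull leaves the linear span unchanged.\<close>

lemma dim_poset_cone: "dim (poset_cone r) = dim (root_vecs r)"
proof (rule span_eq_dim)
  show "span (poset_cone r) = span (root_vecs r)"
    unfolding poset_cone_eq span_eq
  proof
    show "convex_cone hull root_vecs r \<subseteq> span (root_vecs r)"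
      by (rule hull_minimal) (auto intro: span_base convex_cone_span)
    show "root_vecs r \<subseteq> span (convex_cone hull root_vecs r)"
      using hull_subset[of "root_vecs r" convex_cone] span_superset by blast
  qed
qed

text \<open>Induction on the size of the interval: a relation that is not a cover has an
  intermediate element, and both subintervals are strictly smaller.\<close>

lemma order_subset_rtrancl_hasse:
  assumes "finite A" "partial_order_on A r" "(x, y) \<in> r"
  shows "(x, y) \<in> (hasse A r)\<^sup>*"
  using assms(3)
proof (induction "card {z\<in>A. (x, z) \<in> r \<and> (z, y) \<in> r}" arbitrary: x y rule: less_induct)
  case less
  have tr: "trans r" and an: "antisym r" and rf: "refl_on A r" and sub: "r \<subseteq> A \<times> A"
    using assms(2) by (auto dest: partial_order_onD)
  let ?I = "\<lambda>x y. {z\<in>A. (x, z) \<in> r \<and> (z, y) \<in> r}"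
  show ?case
  proof (cases "x = y \<or> (x, y) \<in> hasse A r")
    case False
    then obtain z where z: "z \<in> A" "z \<noteq> x" "z \<noteq> y" "(x, z) \<in> r" "(z, y) \<in> r"
      using less.prems by (auto simp: hasse_def)
    have "x \<in> A" "y \<in> A" using sub less.prems by auto
    have "?I x z \<subset> ?I x y"
    proof
      show "?I x z \<subseteq> ?I x y" using z tr by (auto dest: transD)
      have "y \<in> ?I x y" using \<open>y \<in> A\<close> less.prems rf by (auto simp: refl_on_def)
      moreover have "y \<notin> ?I x z" using z an by (auto dest: antisymD)
      ultimately show "?I x z \<noteq> ?I x y" by blast
    qed
    moreover have "?I z y \<subset> ?I x y"
    proof
      show "?I z y \<subseteq> ?I x y" using z tr by (auto dest: transD)
      have "x \<in> ?I x y" using \<open>x \<in> A\<close> less.prems rf by (auto simp: refl_on_def)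
      moreover have "x \<notin> ?I z y" using z an by (auto dest: antisymD)
      ultimately show "?I z y \<noteq> ?I x y" by blast
    qed
    ultimately have "card (?I x z) < card (?I x y)" "card (?I z y) < card (?I x y)"
      using assms(1) by (auto intro!: psubset_card_mono)
    then show ?thesis using less.hyps z(4,5) by (meson rtrancl_trans)
  qed auto
qed

text \<open>
  With a representative chosen in each component, the differences \<open>e\<^sub>x - e\<^sub>y\<close>, \<open>x\<close> running over the
  other elements and \<open>y\<close> being the representative of \<open>x\<close>, form a basis of the span of the root vectors.
\<close>

lemma dim_root_vecs:
  assumes "finite A" "partial_order_on A r"
  shows "dim (root_vecs r) = rk (class_of A r)"
proof -
  let ?H = "hasse A r \<union> (hasse A r)\<inverse>"
  \<comment> \<open>The choice is made from the component as a set, so \<open>rep\<close> is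
    constant on each component.\<close>
  define rep where "rep x = (SOME y. y \<in> ?H\<^sup>* `` {x})" for x
  define N where "N = {x\<in>A. rep x \<noteq> x}"
  define b where "b x = (unit_vec x - unit_vec (rep x) :: nat \<Rightarrow>\<^sub>0 real)" for x
  have sub: "r \<subseteq> A \<times> A" using assms(2) by (rule partial_order_onD(4))
  have sym: "sym (?H\<^sup>*)" by (rule sym_rtrancl) (auto simp: sym_def)
  have rep: "(x, rep x) \<in> ?H\<^sup>*" for x
    using someI[of "\<lambda>y. y \<in> ?H\<^sup>* `` {x}" x] by (simp add: rep_def)
  have cls: "?H\<^sup>* `` {x} = ?H\<^sup>* `` {y}" if "(x, y) \<in> ?H\<^sup>*" for x y
    using that symD[OF sym that] by (auto intro: rtrancl_trans)
  then have rep_eq: "rep x = rep y" if "(x, y) \<in> ?H\<^sup>*" for x y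
    using that by (simp add: rep_def)
  have rep_rep: "rep (rep x) = rep x" for x using rep_eq[OF rep[of x]] by simp
  have closed: "y \<in> A" if "(x, y) \<in> ?H\<^sup>*" "x \<in> A" for x y
    using that by (induction rule: rtrancl_induct) (use sub in \<open>auto simp: hasse_def\<close>)
  have finN: "finite N" using assms(1) by (simp add: N_def)
  \<comment> \<open>Differences telescope along a path of the Hasse diagram; signs are free inside
    the span.\<close>
  have diff: "unit_vec x - unit_vec y \<in> span (root_vecs r)" if "(x, y) \<in> ?H\<^sup>*" for x y
    using that
  proof (induction rule: rtrancl_induct)
    case base
    then show ?case by (simp add: span_zero)
  next
    case (step y z)
    have pos: "unit_vec i - unit_vec j \<in> span (root_vecs r)" if "(i, j) \<in> hasse A r" for i j
      using that by (intro span_base) (auto simp: hasse_def root_vecs_def)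
    have "unit_vec y - unit_vec z \<in> span (root_vecs r)"
      using step.hyps(2) pos[of y z] span_neg[OF pos[of z y]] by auto
    from span_add[OF step.IH this] show ?case by simp
  qed
  have "span (root_vecs r) = span (b ` N)"
    unfolding span_eq
  proof (rule conjI[rotated])
    show "b ` N \<subseteq> span (root_vecs r)" using diff[OF rep] by (auto simp: b_def)
    have bN: "b x \<in> span (b ` N)" if "x \<in> A" for x
    proof (cases "x \<in> N")
      case False
      then show ?thesis using that by (simp add: N_def b_def span_zero)
    qed (auto intro: span_base)
    show "root_vecs r \<subseteq> span (b ` N)"
    proof
      fix v assume "v \<in> root_vecs r"
      then obtain i j where v: "v = unit_vec i - unit_vec j" and ij: "(i, j) \<in> r"
        by (auto simp: root_vecs_def)
      have "(i, j) \<in> ?H\<^sup>*"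
        using order_subset_rtrancl_hasse[OF assms ij] rtrancl_mono[of "hasse A r" ?H] by blast
      then have "v = b i - b j" unfolding v b_def by (simp add: rep_eq)
      then show "v \<in> span (b ` N)" using bN ij sub by (auto intro: span_diff)
    qed
  qed
  then have "dim (root_vecs r) = dim (b ` N)" by (rule span_eq_dim)
  \<comment> \<open>Representatives lie outside \<open>N\<close>, so among the vectors
    \<open>b y\<close> only \<open>b x\<close> has a nonzero coordinate at \<open>x\<close>. This
    gives injectivity and independence.\<close>
  have look: "Poly_Mapping.lookup (b y) x = (if x = y then 1 else 0)" if "x \<in> N" "y \<in> N" for x y
  proof -
    have "rep y \<noteq> x" using that rep_rep[of y] by (auto simp: N_def)
    then show ?thesis using that by (auto simp: b_def N_def lookup_minus lookup_unit_vec)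
  qed
  have inj: "inj_on b N"
  proof (rule inj_onI)
    fix x y assume "x \<in> N" "y \<in> N" "b x = b y"
    then show "x = y" using look[of x x] look[of x y] by (auto split: if_splits)
  qed
  have "independent (b ` N)"
  proof
    assume "dependent (b ` N)"
    then obtain x where x: "x \<in> N" "b x \<in> span (b ` N - {b x})" by (auto simp: dependent_def)
    have "subspace {v :: nat \<Rightarrow>\<^sub>0 real. Poly_Mapping.lookup v x = 0}"
      by (auto simp: subspace_def lookup_add lookup_scaleR)
    moreover have "b ` N - {b x} \<subseteq> {v. Poly_Mapping.lookup v x = 0}" using look x(1) by auto
    ultimately have "span (b ` N - {b x}) \<subseteq> {v. Poly_Mapping.lookup v x = 0}"
      by (rule span_minimal[rotated])
    then show False using x look[OF x(1) x(1)] by auto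
  qed
  then have "dim (b ` N) = card N" using inj by (simp add: dim_eq_card_independent card_image)
  have comp: "components A r = (\<lambda>x. ?H\<^sup>* `` {x}) ` A"
    by (auto simp: components_def quotient_def)
  \<comment> \<open>Components are counted by their representatives, which are exactly the elements
    of \<open>A\<close> outside \<open>N\<close>.\<close>
  have "bij_betw (\<lambda>x. ?H\<^sup>* `` {x}) (rep ` A) (components A r)"
    unfolding bij_betw_def comp
  proof
    show "inj_on (\<lambda>x. ?H\<^sup>* `` {x}) (rep ` A)"
    proof (rule inj_onI)
      fix x y assume xy: "x \<in> rep ` A" "y \<in> rep ` A" "?H\<^sup>* `` {x} = ?H\<^sup>* `` {y}"
      then have "rep x = rep y" by (simp add: rep_def)
      then show "x = y" using xy rep_rep by auto
    qed
    show "(\<lambda>x. ?H\<^sup>* `` {x}) ` rep ` A = (\<lambda>x. ?H\<^sup>* `` {x}) ` A"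
      unfolding image_image using cls[OF rep] by simp
  qed
  then have "card (components A r) = card (rep ` A)" by (simp add: bij_betw_same_card)
  moreover have "rep ` A = A - N"
  proof -
    have "rep x \<in> A - N" if "x \<in> A" for x using closed[OF rep that] rep_rep by (simp add: N_def)
    moreover have "x \<in> rep ` A" if "x \<in> A - N" for x
      using that by (auto simp: N_def intro: image_eqI[of _ _ x])
    ultimately show ?thesis by blast
  qed
  moreover have "card (A - N) = card A - card N" "card N \<le> card A"
    using assms(1) finN by (auto simp: N_def intro!: card_Diff_subset card_mono)
  ultimately show ?thesis
    using rk_class_of[OF assms] \<open>dim (root_vecs r) = dim (b ` N)\<close> \<open>dim (b ` N) = card N\<close> by simp
qed

text \<open>Keeping only relations inside fibres gives the disjoint union of the fibres, whose ranks
  add. The partial order is carried through the induction because \<open>class_of_Un\<close>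
  requires it.\<close>

lemma rk_fibres:
  assumes "finite A" "partial_order_on A r" "finite V"
  shows "partial_order_on {x\<in>A. f x \<in> V} {(x, y)\<in>r. f x = f y \<and> f x \<in> V} \<and>
    rk (class_of {x\<in>A. f x \<in> V} {(x, y)\<in>r. f x = f y \<and> f x \<in> V}) =
    (\<Sum>v\<in>V. rk (subposet_class r {x\<in>A. f x = v}))"
  using assms(3)
proof (induction V rule: finite_induct)
  case empty
  then show ?case by (simp add: class_of_empty rk_0)
next
  case (insert v V)
  let ?A = "{x\<in>A. f x \<in> V}" and ?r = "{(x, y)\<in>r. f x = f y \<and> f x \<in> V}"
  let ?F = "{x\<in>A. f x = v}"
  have sub: "r \<subseteq> A \<times> A" using assms(2) by (rule partial_order_onD(4))
  have F: "finite ?F" "partial_order_on ?F (Restr r ?F)"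
    using assms by (auto intro: partial_order_on_Restr)
  have dis: "?F \<inter> ?A = {}" using insert.hyps by auto
  have "{x\<in>A. f x \<in> insert v V} = ?F \<union> ?A" by auto
  moreover have "{(x, y)\<in>r. f x = f y \<and> f x \<in> insert v V} = Restr r ?F \<union> ?r"
    using sub by auto
  moreover have "partial_order_on (?F \<union> ?A) (Restr r ?F \<union> ?r)"
    using insert.IH by (intro partial_order_on_Un[OF F(2) _ dis]) simp
  moreover have "class_of (?F \<union> ?A) (Restr r ?F \<union> ?r) = subposet_class r ?F + class_of ?A ?r"
    using insert.IH assms(1) by (intro class_of_Un[OF F _ _ dis]) auto
  ultimately show ?case using insert.IH insert.hyps by (simp add: rk_add)
qed

section \<open>Maximizing faces of a poset cone\<close>

lemma dot_root_vec:
  assumes "partial_order_on {1..n} P" "(i, j) \<in> P"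
  shows "dot n \<omega> (unit_vec i - unit_vec j) = Poly_Mapping.lookup \<omega> i - Poly_Mapping.lookup \<omega> j"
proof -
  have "i \<in> {1..n}" "j \<in> {1..n}" using partial_order_onD(4)[OF assms(1)] assms(2) by auto
  then show ?thesis using linear_dot[of n \<omega>] by (simp add: linear_diff dot_unit_vec)
qed

text \<open>On a generator the functional is a difference of two entries of \<omega>, so it is
  nonpositive on the cone iff \<omega> is order-preserving. Its zero set is then generated by the
  generators on which it vanishes.\<close>

lemma poset_cone_argmax:
  assumes "partial_order_on {1..n} P"
  shows "{x\<in>poset_cone P. \<forall>y\<in>poset_cone P. dot n \<omega> y \<le> dot n \<omega> x} =
    (if \<forall>(i, j)\<in>P. Poly_Mapping.lookup \<omega> i \<le> Poly_Mapping.lookup \<omega> j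
     then poset_cone {(i, j)\<in>P. Poly_Mapping.lookup \<omega> i = Poly_Mapping.lookup \<omega> j} else {})"
    (is "?max = _")
proof (cases "\<forall>(i, j)\<in>P. Poly_Mapping.lookup \<omega> i \<le> Poly_Mapping.lookup \<omega> j")
  case True
  let ?T = "{(i, j)\<in>P. Poly_Mapping.lookup \<omega> i = Poly_Mapping.lookup \<omega> j}"
  have np: "dot n \<omega> g \<le> 0" if "g \<in> root_vecs P" for g
    using that True dot_root_vec[OF assms] by (auto simp: root_vecs_def)
  have T: "root_vecs ?T = {g\<in>root_vecs P. dot n \<omega> g = 0}"
  proof (intro set_eqI iffI)
    fix g assume "g \<in> root_vecs ?T"
    then show "g \<in> {g\<in>root_vecs P. dot n \<omega> g = 0}"
      using dot_root_vec[OF assms] by (force simp: root_vecs_def)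
  next
    fix g assume "g \<in> {g\<in>root_vecs P. dot n \<omega> g = 0}"
    then obtain i j where ij: "g = unit_vec i - unit_vec j" "(i, j) \<in> P" "i \<noteq> j" "dot n \<omega> g = 0"
      by (auto simp: root_vecs_def)
    then have "(i, j) \<in> ?T" using dot_root_vec[OF assms ij(2), of \<omega>] by simp
    then show "g \<in> root_vecs ?T" using ij unfolding root_vecs_def by blast
  qed
  note hull = linear_nonpos_cone_hull[OF linear_dot np, folded poset_cone_eq]
  have "?max = {x\<in>poset_cone P. dot n \<omega> x = 0}"
    using argmax_linear_cone[OF linear_dot convex_cone_convex_cone_hull[of "root_vecs P"], of n \<omega>] hull(1)
    by (auto simp: poset_cone_eq)
  also have "\<dots> = poset_cone ?T"
  proof
    show "{x\<in>poset_cone P. dot n \<omega> x = 0} \<subseteq> poset_cone ?T"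
      using hull(2) unfolding poset_cone_eq T by blast
    show "poset_cone ?T \<subseteq> {x\<in>poset_cone P. dot n \<omega> x = 0}"
      unfolding poset_cone_eq T
    proof (rule hull_minimal)
      have "linear (dot n \<omega>)" by (rule linear_dot)
      then show "convex_cone {x \<in> convex_cone hull root_vecs P. dot n \<omega> x = 0}"
        by (intro convex_coneI) (auto simp: linear_0 linear_add linear_scale
            intro: convex_cone_hull_contains_0 convex_cone_hull_add convex_cone_hull_mul)
    qed (auto intro: hull_inc)
  qed
  finally show ?thesis unfolding if_P[OF True] .
next
  case False
  then obtain i j where ij: "(i, j) \<in> P" "Poly_Mapping.lookup \<omega> i > Poly_Mapping.lookup \<omega> j" by fastforce
  let ?g = "unit_vec i - unit_vec j :: nat \<Rightarrow>\<^sub>0 real"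
  have "?g \<in> poset_cone P"
    unfolding poset_cone_eq using ij by (intro hull_inc) (auto simp: root_vecs_def)
  moreover have "dot n \<omega> ?g > 0" using dot_root_vec[OF assms ij(1)] ij(2) by simp
  ultimately have "\<not> (\<forall>y\<in>poset_cone P. dot n \<omega> y \<le> 0)" by (meson not_le)
  then have "?max = {}"
    using argmax_linear_cone[OF linear_dot convex_cone_convex_cone_hull[of "root_vecs P"], of n \<omega>]
    unfolding poset_cone_eq by (simp only: if_False)
  then show ?thesis unfolding if_not_P[OF False] .
qed

text \<open>The tight cone is the zero set of a functional that is nonpositive on the whole cone.
  Thus every order-preserving vector is assigned to a face over which the enumerator sums.\<close>

lemma poset_cone_tight_face:
  fixes \<omega> :: "nat \<Rightarrow>\<^sub>0 real"
  assumes "partial_order_on {1..n} P"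
    "\<forall>(i, j)\<in>P. Poly_Mapping.lookup \<omega> i \<le> Poly_Mapping.lookup \<omega> j"
  shows "poset_cone {(i, j)\<in>P. Poly_Mapping.lookup \<omega> i = Poly_Mapping.lookup \<omega> j} \<in>
    nonempty_faces (poset_cone P)"
proof -
  let ?F = "poset_cone {(i, j)\<in>P. Poly_Mapping.lookup \<omega> i = Poly_Mapping.lookup \<omega> j}"
  have max: "{x\<in>poset_cone P. \<forall>y\<in>poset_cone P. dot n \<omega> y \<le> dot n \<omega> x} = ?F"
    using poset_cone_argmax[OF assms(1), of \<omega>] unfolding if_P[OF assms(2)] .
  have "0 \<in> ?F" unfolding poset_cone_eq by (rule convex_cone_hull_contains_0)
  have cone: "convex_cone (poset_cone P)" unfolding poset_cone_eq by (rule convex_cone_convex_cone_hull)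
  have "\<forall>y\<in>poset_cone P. dot n \<omega> y \<le> 0"
    and "?F = {x\<in>poset_cone P. dot n \<omega> x = 0}"
    using argmax_linear_cone[OF linear_dot cone, of n \<omega>] \<open>0 \<in> ?F\<close> unfolding max
    by (auto split: if_splits)
  then have "?F face_of poset_cone P"
    using zero_set_face_of[OF linear_dot, of "poset_cone P" n \<omega>] cone by (simp add: convex_cone_def)
  then show ?thesis using \<open>0 \<in> ?F\<close> by (auto simp: nonempty_faces_def)
qed

lemma finite_poset_cone_faces:
  "finite P \<Longrightarrow> finite (nonempty_faces (poset_cone P))"
  unfolding nonempty_faces_def poset_cone_eq
  by (rule finite_nonempty_faces_cone_hull) (rule finite_root_vecs)

section \<open>Positive integer vectors and the expansion of the enumerator\<close>

lemma pos_int_vecs_lookup: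
  assumes "\<omega> \<in> pos_int_vecs n" "i \<in> {1..n}"
  shows "Poly_Mapping.lookup \<omega> i = real (nat \<lfloor>Poly_Mapping.lookup \<omega> i\<rfloor>)"
    "nat \<lfloor>Poly_Mapping.lookup \<omega> i\<rfloor> > 0"
proof -
  have "Poly_Mapping.lookup \<omega> i \<in> \<int>" "Poly_Mapping.lookup \<omega> i > 0"
    using assms unfolding pos_int_vecs_def by blast+
  then obtain k :: int where "Poly_Mapping.lookup \<omega> i = of_int k" "k > 0" by (auto elim!: Ints_cases)
  then show "Poly_Mapping.lookup \<omega> i = real (nat \<lfloor>Poly_Mapping.lookup \<omega> i\<rfloor>)"
    "nat \<lfloor>Poly_Mapping.lookup \<omega> i\<rfloor> > 0" by simp_all
qed

text \<open>The vectors contributing to the coefficient of \<open>m\<close>, for all faces together: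
  order preservation expresses that the functional is bounded on the cone.\<close>

definition order_vecs :: "nat \<Rightarrow> nat rel \<Rightarrow> (nat \<Rightarrow>\<^sub>0 nat) \<Rightarrow> (nat \<Rightarrow>\<^sub>0 real) set" where
  "order_vecs n P m = {\<omega>\<in>pos_int_vecs n. vec_monomial n \<omega> = m \<and>
    (\<forall>(i, j)\<in>P. Poly_Mapping.lookup \<omega> i \<le> Poly_Mapping.lookup \<omega> j)}"

definition vec_of_map :: "nat \<Rightarrow> (nat \<Rightarrow> nat) \<Rightarrow> (nat \<Rightarrow>\<^sub>0 real)" where
  "vec_of_map n f = (\<Sum>i\<in>{1..n}. Poly_Mapping.single i (real (f i)))"

lemma lookup_vec_of_map: "Poly_Mapping.lookup (vec_of_map n f) i = (if i \<in> {1..n} then real (f i) else 0)"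
  by (simp add: vec_of_map_def lookup_sum lookup_single when_def)

lemma order_vecs_bij:
  assumes "partial_order_on {1..n} P" "0 \<notin> Poly_Mapping.keys m"
  shows "bij_betw (vec_of_map n) (op_maps {1..n} P m) (order_vecs n P m)"
proof (rule bij_betw_byWitness[where f' = "\<lambda>\<omega>. restrict (\<lambda>i. nat \<lfloor>Poly_Mapping.lookup \<omega> i\<rfloor>) {1..n}"])
  let ?g = "\<lambda>\<omega> :: nat \<Rightarrow>\<^sub>0 real. restrict (\<lambda>i. nat \<lfloor>Poly_Mapping.lookup \<omega> i\<rfloor>) {1..n}"
  have sub: "P \<subseteq> {1..n} \<times> {1..n}" using assms(1) by (rule partial_order_onD(4))
  show gv: "\<forall>f\<in>op_maps {1..n} P m. ?g (vec_of_map n f) = f"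
    by (auto simp: op_maps_def lookup_vec_of_map fun_eq_iff extensional_def)
  have mono: "vec_monomial n \<omega> = map_monomial {1..n} (?g \<omega>)" for \<omega>
    unfolding vec_monomial_def map_monomial_def by (rule sum.cong) auto
  have int: "Poly_Mapping.lookup \<omega> i = real (?g \<omega> i)" if "\<omega> \<in> pos_int_vecs n" "i \<in> {1..n}" for \<omega> i
    using pos_int_vecs_lookup(1)[OF that] that(2) by simp
  show "\<forall>\<omega>\<in>order_vecs n P m. vec_of_map n (?g \<omega>) = \<omega>"
  proof
    fix \<omega> assume "\<omega> \<in> order_vecs n P m"
    then have \<omega>: "\<omega> \<in> pos_int_vecs n" by (simp add: order_vecs_def)
    show "vec_of_map n (?g \<omega>) = \<omega>"
    proof (rule poly_mapping_eqI)
      fix i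
      show "Poly_Mapping.lookup (vec_of_map n (?g \<omega>)) i = Poly_Mapping.lookup \<omega> i"
      proof (cases "i \<in> {1..n}")
        case True
        then show ?thesis using int[OF \<omega> True] by (simp only: lookup_vec_of_map if_True)
      next
        case False
        then have "Poly_Mapping.lookup \<omega> i = 0"
          using \<omega> by (auto simp: pos_int_vecs_def Rn_def in_keys_iff subset_iff)
        then show ?thesis using False by (simp only: lookup_vec_of_map if_False)
      qed
    qed
  qed
  show "vec_of_map n ` op_maps {1..n} P m \<subseteq> order_vecs n P m"
  proof clarify
    fix f assume f: "f \<in> op_maps {1..n} P m"
    \<comment> \<open>The values of \<open>f\<close> are keys of \<open>m\<close>, and 0 is not
      among them.\<close>
    have "f i > 0" if "i \<in> {1..n}" for i
    proof -
      have "f i \<in> Poly_Mapping.keys m" using f that by (auto simp: op_maps_def keys_map_monomial)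
      then show ?thesis using assms(2) by (cases "f i") auto
    qed
    then have "vec_of_map n f \<in> pos_int_vecs n"
      by (auto simp: pos_int_vecs_def Rn_def lookup_vec_of_map in_keys_iff split: if_splits)
    moreover have "vec_monomial n (vec_of_map n f) = m"
      unfolding mono using gv f by (simp add: op_maps_def)
    moreover have "Poly_Mapping.lookup (vec_of_map n f) i \<le> Poly_Mapping.lookup (vec_of_map n f) j"
      if "(i, j) \<in> P" for i j
    proof -
      have "i \<in> {1..n}" "j \<in> {1..n}" using sub that by auto
      then show ?thesis using f that by (simp add: op_maps_def lookup_vec_of_map)
    qed
    ultimately show "vec_of_map n f \<in> order_vecs n P m" by (auto simp: order_vecs_def)
  qed
  show "?g ` order_vecs n P m \<subseteq> op_maps {1..n} P m"
  proof clarify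
    fix \<omega> assume \<omega>: "\<omega> \<in> order_vecs n P m"
    then have "map_monomial {1..n} (?g \<omega>) = m" by (simp add: order_vecs_def mono)
    moreover have "?g \<omega> x \<le> ?g \<omega> y" if "(x, y) \<in> P" "x \<in> {1..n}" "y \<in> {1..n}" for x y
      using \<omega> that by (auto simp: order_vecs_def intro!: nat_mono floor_mono)
    ultimately show "?g \<omega> \<in> op_maps {1..n} P m" unfolding op_maps_def by blast
  qed
qed

text \<open>Positive entries never produce the variable with index 0.\<close>

lemma order_vecs_empty:
  assumes "0 \<in> Poly_Mapping.keys m"
  shows "order_vecs n P m = {}"
proof -
  have "False" if "\<omega> \<in> order_vecs n P m" for \<omega>
  proof -
    have \<omega>: "vec_monomial n \<omega> = m" "\<omega> \<in> pos_int_vecs n" using that by (auto simp: order_vecs_def)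
    have "nat \<lfloor>Poly_Mapping.lookup \<omega> i\<rfloor> \<noteq> 0" if "i \<in> {1..n}" for i
      using pos_int_vecs_lookup(2)[OF \<omega>(2) that] by simp
    then have "Poly_Mapping.lookup (vec_monomial n \<omega>) 0 = 0"
      by (auto simp: vec_monomial_def lookup_sum lookup_single when_def)
    then show False using assms \<omega>(1) by (simp add: in_keys_iff)
  qed
  then show ?thesis by blast
qed

text \<open>An order-preserving vector lies in the open normal cone of exactly one face, its tight
  face. The double sum over faces and vectors therefore collapses to one over vectors, that is, over
  order-preserving maps.\<close>

lemma cone_enumerator_poset_cone:
  assumes "partial_order_on {1..n} P"
  shows "(cone_enumerator n (poset_cone P) m :: 'k::field poly fract) =
    (if 0 \<in> Poly_Mapping.keys m then 0 else (\<Sum>f\<in>op_maps {1..n} P m.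
      qvar ^ dim (poset_cone {(i, j)\<in>P. f i = f j})))"
proof -
  let ?L = Poly_Mapping.lookup
  let ?face = "\<lambda>\<omega>. poset_cone {(i, j)\<in>P. ?L \<omega> i = ?L \<omega> j}"
  let ?Fs = "nonempty_faces (poset_cone P)"
  have sub: "P \<subseteq> {1..n} \<times> {1..n}" using assms by (rule partial_order_onD(4))
  then have finP: "finite P" by (rule finite_subset) simp
  have fin: "finite (order_vecs n P m)"
  proof (cases "0 \<in> Poly_Mapping.keys m")
    case False
    then show ?thesis using bij_betw_finite[OF order_vecs_bij[OF assms False]] finite_op_maps by simp
  qed (simp add: order_vecs_empty)
  have set_eq: "{\<omega> \<in> pos_int_vecs n \<inter> open_normal_cone n (poset_cone P) G. vec_monomial n \<omega> = m} =
      {\<omega> \<in> order_vecs n P m. ?face \<omega> = G}" if "G \<in> ?Fs" for G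
  proof (rule Collect_cong)
    fix \<omega>
    show "\<omega> \<in> pos_int_vecs n \<inter> open_normal_cone n (poset_cone P) G \<and> vec_monomial n \<omega> = m \<longleftrightarrow>
        \<omega> \<in> order_vecs n P m \<and> ?face \<omega> = G"
      using that unfolding open_normal_cone_def mem_Collect_eq poset_cone_argmax[OF assms]
      by (auto simp: order_vecs_def nonempty_faces_def pos_int_vecs_def split: if_splits)
  qed
  have "(cone_enumerator n (poset_cone P) m :: 'k poly fract) =
      (\<Sum>G\<in>?Fs. \<Sum>\<omega> | \<omega> \<in> order_vecs n P m \<and> ?face \<omega> = G. qvar ^ dim (?face \<omega>))"
    unfolding cone_enumerator_def
  proof (rule sum.cong[OF refl])
    fix G assume "G \<in> ?Fs"
    have "(\<Sum>\<omega> | \<omega> \<in> order_vecs n P m \<and> ?face \<omega> = G. qvar ^ dim (?face \<omega>)) =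
        (\<Sum>\<omega> | \<omega> \<in> order_vecs n P m \<and> ?face \<omega> = G. qvar ^ dim G :: 'k poly fract)"
      by (rule sum.cong) auto
    then show "qvar ^ dim G * of_nat (card {\<omega> \<in> pos_int_vecs n \<inter> open_normal_cone n (poset_cone P) G.
        vec_monomial n \<omega> = m}) =
      (\<Sum>\<omega> | \<omega> \<in> order_vecs n P m \<and> ?face \<omega> = G. qvar ^ dim (?face \<omega>) :: 'k poly fract)"
      unfolding set_eq[OF \<open>G \<in> ?Fs\<close>] by (simp add: mult.commute)
  qed
  \<comment> \<open>Vectors are grouped by their tight face.\<close>
  also have "\<dots> = (\<Sum>\<omega>\<in>order_vecs n P m. qvar ^ dim (?face \<omega>))"
    using poset_cone_tight_face[OF assms]
    by (intro sum.group fin finite_poset_cone_faces finP) (auto simp: order_vecs_def)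
  finally have eq: "(cone_enumerator n (poset_cone P) m :: 'k poly fract) =
    (\<Sum>\<omega>\<in>order_vecs n P m. qvar ^ dim (?face \<omega>))" .
  show ?thesis
  proof (cases "0 \<in> Poly_Mapping.keys m")
    case False
    have "{(i, j)\<in>P. ?L (vec_of_map n f) i = ?L (vec_of_map n f) j} = {(i, j)\<in>P. f i = f j}" for f
      using sub by (auto simp: lookup_vec_of_map)
    then show ?thesis
      unfolding eq using False
      by (subst sum.reindex_bij_betw[OF order_vecs_bij[OF assms False], symmetric]) simp
  qed (simp add: eq order_vecs_empty)
qed

theorem theorem4p2:
  fixes n :: nat and P :: "nat rel"
  assumes "partial_order_on {1..n} P"
  shows "(cone_enumerator n (poset_cone P) :: 'k::field poly fract series) =
    qsym_series (Psi_q (basis (class_of {1..n} P)))"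
proof
  fix m :: "nat \<Rightarrow>\<^sub>0 nat"
  let ?K = "Poly_Mapping.keys m"
  have sub: "P \<subseteq> {1..n} \<times> {1..n}" using assms by (rule partial_order_onD(4))
  have "qvar ^ dim (poset_cone {(i, j)\<in>P. f i = f j}) =
      (\<Prod>j\<in>?K. qvar ^ rk (subposet_class P {x\<in>{1..n}. f x = j}) :: 'k poly fract)"
    if "f \<in> op_maps {1..n} P m" for f
  proof -
    have K: "f x \<in> ?K" if "x \<in> {1..n}" for x
      using \<open>f \<in> op_maps {1..n} P m\<close> that by (auto simp: op_maps_def keys_map_monomial)
    \<comment> \<open>All values of \<open>f\<close> are keys of \<open>m\<close>, so taking
      \<open>?K\<close> as the value set in \<open>rk_fibres\<close> discards nothing.\<close>
    then have A: "{x\<in>{1..n}. f x \<in> ?K} = {1..n}" by blast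
    have r: "{(x, y)\<in>P. f x = f y \<and> f x \<in> ?K} = {(x, y)\<in>P. f x = f y}" using K sub by blast
    note fib = rk_fibres[OF finite_atLeastAtMost assms, of ?K f, unfolded A r]
    have "dim (poset_cone {(i, j)\<in>P. f i = f j}) = rk (class_of {1..n} {(i, j)\<in>P. f i = f j})"
      unfolding dim_poset_cone using fib by (intro dim_root_vecs) auto
    then show ?thesis using fib by (simp add: power_sum)
  qed
  then show "(cone_enumerator n (poset_cone P) m :: 'k poly fract) =
      qsym_series (Psi_q (basis (class_of {1..n} P))) m"
    unfolding Psi_q_eq lin_ext_basis cone_enumerator_poset_cone[OF assms]
      qsym_series_class_image[OF finite_atLeastAtMost assms]
    by (auto intro!: sum.cong)
qed

end
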